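(* Let $X=\mathbb{P}(L\oplus\mathcal{O})$ be the minimal ruled surface over a genus $2$ Riemann surface $\Sigma$, where $L\to\Sigma$ is a holomorphic line bundle of degree $-1$. For $a,b>0$ consider the normalized Kähler classes $\Omega_a:=2\pi(\mathrm{C}+aD_\infty)$ and $\Omega_b:=2\pi(\mathrm{C}+bD_\infty)$ on $X$. Let $k_0\approx 12.451$ be the unique positive root of the polynomial $$\vartheta(x):=9x^4-88x^3-280x^2-240x-48.$$ Then for every $a>k_0$ there exists $\delta_a>0$ such that for all $b\in(0,\delta_a)$ the pair $(\Omega_a,\Omega_b)$ does not admit a coupled extremal Kähler metric $(\omega,\chi)\in\Omega_a\times\Omega_b$ satisfying the Calabi ansatz.
   Context: Surface. $\Sigma$ is a compact Riemann surface of genus $2$ with a fixed Kähler metric $\omega_\Sigma$ of scalar curvature $R(\omega_\Sigma)=-2$ (so $\int_\Sigma\omega_\Sigma=2\pi$). $L\to\Sigma$ is a holomorphic line bundle of degree $-1$ with a Hermitian metric $h$ whose curvature form $-\sqrt{-1}\partial\bar\partial\log h$ equals $-\omega_\Sigma$; $\mathcal{O}$ is the trivial line bundle. $X=\mathbb{P}(L\oplus\mathcal{O})$ is the associated $\mathbb{P}^1$-bundle over $\Sigma$. $\mathrm{C}$ is the Poincaré dual of a fiber; $D_\infty$ and $D_0$ are the images in $X$ of the subbundles $L\oplus\{0\}$ and $\{0\}\oplus\mathcal{O}$ (infinity divisor and zero divisor), identified with their Poincaré duals in $H^2(X,\mathbb{R})$ when appearing in cohomology classes. The complement $X\setminus(D_0\cup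 D_\infty)$ is identified with $L$ minus its zero section, $D_0$ being the zero section; $p$ denotes the projection to $\Sigma$. The Kähler classes of $X$ are exactly $a_1\mathrm{C}+a_2D_\infty$ with $a_1,a_2>0$. Conventions. On a Kähler surface, $\mathrm{Ric}(\omega)=-\sqrt{-1}\partial\bar\partial\log(\omega^2)$; for a $(1,1)$-form $\alpha$, $\Lambda_\omega\alpha=2\,\alpha\wedge\omega/\omega^2$; $R(\omega)=\Lambda_\omega\mathrm{Ric}(\omega)$. For a function $f$, $\nabla^{1,0}_\omega f=g^{j\bar k}(\partial_{\bar k}f)\partial_j$, where $g$ is the metric of $\omega$. Coupled extremal pair. A pair of Kähler metrics $(\omega,\chi)$ on $X$ is coupled extremal if $\mathrm{Ric}(\omega)=\mathrm{Ric}(\chi)$ and $\bar\partial\big(\nabla^{1,0}_\omega(R(\omega)-\Lambda_\omega(\omega+\chi))\big)=0$ (since $\Lambda_\omega\omega=2$ is constant, one may replace $\Lambda_\omega(\omega+\chi)$ by $\Lambda_\omega\chi$). Calabi ansatz. Let $s$ be the logarithm of the fiberwise norm squared on $X\setminus(D_0\cup D_\infty)$: $s=\ln h(z)+\ln|w|^2$, where $z$ is a local coordinate on $\Sigma$ and $w$ a fiber coordinate on $L$. A Kähler metric $\omega\in\Omega_a$ satisfies the Calabi ansatz if on $X\setminus(D_0\cup D_\infty)$ it has the form $\omega=p^*\omega_\Sigma+\sqrt{-1}\partial\bar\partial u(s)$ with $u\in C^\infty(\mathbb{R},\mathbb{R})$ strictly convex, $s\mapsto s+u(s)$ strictly increasing,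 $\lim_{s\to-\infty}u'(s)=0$ and $\lim_{s\to\infty}u'(s)=a$ (and it extends smoothly to a Kähler metric on all of $X$). A pair $(\omega,\chi)\in\Omega_a\times\Omega_b$ satisfies the Calabi ansatz if $\omega$ does (with parameter $a$) and $\chi$ does (with parameter $b$). *)

theory Defs
  imports "HOL-Analysis.Analysis" "HOL-Homology.Homology"
begin

section \<open>Smooth functions and complex structures on Euclidean spaces\<close>

primrec Ck_on :: "nat \<Rightarrow> 'a::real_normed_vector set \<Rightarrow> ('a \<Rightarrow> 'b::real_normed_vector) \<Rightarrow> bool" where
  "Ck_on 0 S f \<longleftrightarrow> continuous_on S f"
| "Ck_on (Suc k) S f \<longleftrightarrow>
     (\<forall>x\<in>S. f differentiable (at x)) \<and> (\<forall>v. Ck_on k S (\<lambda>x. frechet_derivative f (at x) v))"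

text \<open>Only used for open \<^term>\<open>S\<close>.\<close>

definition Cinf_on :: "'a::real_normed_vector set \<Rightarrow> ('a \<Rightarrow> 'b::real_normed_vector) \<Rightarrow> bool" where
  "Cinf_on S f \<longleftrightarrow> (\<forall>k. Ck_on k S f)"

definition strictly_convex :: "(real \<Rightarrow> real) \<Rightarrow> bool" where
  "strictly_convex u \<longleftrightarrow>
     (\<forall>x y t. x \<noteq> y \<and> 0 < t \<and> t < 1 \<longrightarrow> u ((1 - t) * x + t * y) < (1 - t) * u x + t * u y)"

text \<open>Multiplication by the imaginary unit, so that Riemann surfaces (charts in \<^typ>\<open>complex\<close>)
  and complex surfaces (charts in \<^typ>\<open>complex^2\<close>) can be treated together.\<close>

class complex_structure = euclidean_space +
  fixes imult :: "'a \<Rightarrow> 'a"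
  assumes imult_add: "imult (x + y) = imult x + imult y"
    and imult_scaleR: "imult (scaleR r x) = scaleR r (imult x)"
    and imult_imult: "imult (imult x) = - x"

instantiation complex :: complex_structure
begin
definition imult_complex :: "complex \<Rightarrow> complex" where
  "imult_complex z = \<i> * z"
instance
  by standard (simp_all add: imult_complex_def algebra_simps)
end

instantiation vec :: (complex_structure, finite) complex_structure
begin
definition imult_vec :: "('a, 'b) vec \<Rightarrow> ('a, 'b) vec" where
  "imult_vec x = (\<chi> i. imult (x $ i))"
instance
  by standard
    (simp_all add: imult_vec_def vec_eq_iff complex_structure_class.imult_add
      complex_structure_class.imult_scaleR complex_structure_class.imult_imult)
end


section \<open>Charts and differential forms\<close>

text \<open>A chart is a domain together with a coordinate map; the values of the coordinate map
  outside the domain are irrelevant.  Differential forms are real-valued and given by their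
  expressions in all charts of an atlas; their values at coordinates outside the image of the
  chart are irrelevant.\<close>

type_synonym ('p, 'c) chart = "'p set \<times> ('p \<Rightarrow> 'c)"
type_synonym 'c form1 = "'c \<Rightarrow> 'c \<Rightarrow> real"
type_synonym 'c form2 = "'c \<Rightarrow> 'c \<Rightarrow> 'c \<Rightarrow> real"

definition chart_image :: "('p, 'c) chart \<Rightarrow> 'c set" where
  "chart_image \<kappa> = snd \<kappa> ` fst \<kappa>"

definition chart_inv :: "('p, 'c) chart \<Rightarrow> 'c \<Rightarrow> 'p" where
  "chart_inv \<kappa> = inv_into (fst \<kappa>) (snd \<kappa>)"

definition chart_overlap :: "('p, 'c) chart \<Rightarrow> ('p, 'c) chart \<Rightarrow> 'c set" where
  "chart_overlap \<kappa> \<kappa>' = snd \<kappa> ` (fst \<kappa> \<inter> fst \<kappa>')"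

definition transition :: "('p, 'c) chart \<Rightarrow> ('p, 'c) chart \<Rightarrow> 'c \<Rightarrow> 'c" where
  "transition \<kappa> \<kappa>' = snd \<kappa>' \<circ> chart_inv \<kappa>"

definition smooth_one_form ::
    "('p, 'c::euclidean_space) chart set \<Rightarrow> (('p, 'c) chart \<Rightarrow> 'c form1) \<Rightarrow> bool" where
  "smooth_one_form A \<theta> \<longleftrightarrow>
     (\<forall>\<kappa>\<in>A. (\<forall>y\<in>chart_image \<kappa>. linear (\<theta> \<kappa> y)) \<and>
             (\<forall>u. Cinf_on (chart_image \<kappa>) (\<lambda>y. \<theta> \<kappa> y u))) \<and>
     (\<forall>\<kappa>\<in>A. \<forall>\<kappa>'\<in>A. \<forall>y\<in>chart_overlap \<kappa> \<kappa>'.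
        let D = frechet_derivative (transition \<kappa> \<kappa>') (at y)
        in \<forall>u. \<theta> \<kappa> y u = \<theta> \<kappa>' (transition \<kappa> \<kappa>' y) (D u))"

definition smooth_two_form ::
    "('p, 'c::euclidean_space) chart set \<Rightarrow> (('p, 'c) chart \<Rightarrow> 'c form2) \<Rightarrow> bool" where
  "smooth_two_form A \<beta> \<longleftrightarrow>
     (\<forall>\<kappa>\<in>A. (\<forall>y\<in>chart_image \<kappa>. bilinear (\<beta> \<kappa> y) \<and> (\<forall>u. \<beta> \<kappa> y u u = 0)) \<and>
             (\<forall>u v. Cinf_on (chart_image \<kappa>) (\<lambda>y. \<beta> \<kappa> y u v))) \<and>
     (\<forall>\<kappa>\<in>A. \<forall>\<kappa>'\<in>A. \<forall>y\<in>chart_overlap \<kappa> \<kappa>'.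
        let D = frechet_derivative (transition \<kappa> \<kappa>') (at y)
        in \<forall>u v. \<beta> \<kappa> y u v = \<beta> \<kappa>' (transition \<kappa> \<kappa>' y) (D u) (D v))"

definition ext_deriv1 :: "'c::euclidean_space form1 \<Rightarrow> 'c form2" where
  "ext_deriv1 \<theta> y u v =
     frechet_derivative (\<lambda>x. \<theta> x v) (at y) u - frechet_derivative (\<lambda>x. \<theta> x u) (at y) v"

definition ext_deriv2 :: "'c::euclidean_space form2 \<Rightarrow> 'c \<Rightarrow> 'c \<Rightarrow> 'c \<Rightarrow> 'c \<Rightarrow> real" where
  "ext_deriv2 \<beta> y u v w =
     frechet_derivative (\<lambda>x. \<beta> x v w) (at y) u - frechet_derivative (\<lambda>x. \<beta> x u w) (at y) v
       + frechet_derivative (\<lambda>x. \<beta> x u v) (at y) w"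

definition closed_two_form ::
    "('p, 'c::euclidean_space) chart set \<Rightarrow> (('p, 'c) chart \<Rightarrow> 'c form2) \<Rightarrow> bool" where
  "closed_two_form A \<beta> \<longleftrightarrow> smooth_two_form A \<beta> \<and>
     (\<forall>\<kappa>\<in>A. \<forall>y\<in>chart_image \<kappa>. \<forall>u v w. ext_deriv2 (\<beta> \<kappa>) y u v w = 0)"

definition kaehler_form ::
    "('p, 'c::complex_structure) chart set \<Rightarrow> (('p, 'c) chart \<Rightarrow> 'c form2) \<Rightarrow> bool" where
  "kaehler_form A \<omega> \<longleftrightarrow> closed_two_form A \<omega> \<and>
     (\<forall>\<kappa>\<in>A. \<forall>y\<in>chart_image \<kappa>.
        (\<forall>u v. \<omega> \<kappa> y (imult u) (imult v) = \<omega> \<kappa> y u v) \<and>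
        (\<forall>u. u \<noteq> 0 \<longrightarrow> \<omega> \<kappa> y u (imult u) > 0))"

text \<open>The real \<open>(1,1)\<close>-form \<open>\<i>\<partial>\<partial>\<close>-bar of \<open>f\<close>, computed as one half of \<open>d d\<^sup>c f\<close>,
  where \<open>d\<^sup>c f = - df \<circ> imult\<close>.  In complex coordinates it is the sum over \<open>j, k\<close> of
  \<open>\<i>\<close> times the mixed Wirtinger derivative of \<open>f\<close> times
  \<open>dz\<^sub>j \<and> cnj dz\<^sub>k\<close>.\<close>

definition iddbar :: "('c::complex_structure \<Rightarrow> real) \<Rightarrow> 'c form2" where
  "iddbar f y u v =
     ext_deriv1 (\<lambda>x w. - frechet_derivative f (at x) (imult w)) y u v / 2"

text \<open>The integral of a top-degree form over a compact oriented manifold, the form being given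
  in each chart by its density \<open>\<mu>\<close> with respect to Lebesgue measure.  By the usual partition of
  unity argument the value does not depend on the choice of \<open>K\<close> and \<open>\<rho>\<close>.\<close>

definition form_integral ::
    "('p, 'c::euclidean_space) chart set \<Rightarrow> (('p, 'c) chart \<Rightarrow> 'c \<Rightarrow> real) \<Rightarrow> real" where
  "form_integral A \<mu> = (THE I. \<exists>K \<rho>.
     finite K \<and> K \<subseteq> A \<and>
     (\<forall>\<kappa>\<in>K. (\<forall>\<kappa>'\<in>A. Cinf_on (chart_image \<kappa>') (\<rho> \<kappa> \<circ> chart_inv \<kappa>')) \<and>
             (\<forall>x\<in>\<Union>(fst ` A). 0 \<le> \<rho> \<kappa> x) \<and>
             (\<exists>C\<subseteq>fst \<kappa>. compact (snd \<kappa> ` C) \<and> (\<forall>x\<in>\<Union>(fst ` A) - C. \<rho> \<kappa> x = 0))) \<and>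
     (\<forall>x\<in>\<Union>(fst ` A). (\<Sum>\<kappa>\<in>K. \<rho> \<kappa> x) = 1) \<and>
     I = (\<Sum>\<kappa>\<in>K. LINT y:chart_image \<kappa>|lborel. \<rho> \<kappa> (chart_inv \<kappa> y) * \<mu> \<kappa> y))"


section \<open>Riemann surfaces and Hermitian holomorphic line bundles\<close>

definition riemann_surface :: "'a topology \<Rightarrow> ('a, complex) chart set \<Rightarrow> bool" where
  "riemann_surface T A \<longleftrightarrow>
     Hausdorff_space T \<and> second_countable T \<and> connected_space T \<and>
     \<Union>(fst ` A) = topspace T \<and>
     (\<forall>\<kappa>\<in>A. openin T (fst \<kappa>) \<and> open (chart_image \<kappa>) \<and>
        homeomorphic_map (subtopology T (fst \<kappa>)) (top_of_set (chart_image \<kappa>)) (snd \<kappa>)) \<and>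
     (\<forall>\<kappa>\<in>A. \<forall>\<kappa>'\<in>A. transition \<kappa> \<kappa>' holomorphic_on chart_overlap \<kappa> \<kappa>')"

text \<open>The first integral homology group of a closed oriented surface of genus \<open>g\<close> is free of
  rank \<open>2g\<close>.\<close>

definition has_genus :: "'a topology \<Rightarrow> nat \<Rightarrow> bool" where
  "has_genus T g \<longleftrightarrow> homology_group 1 T \<cong> free_Abelian_group {..<2 * g}"

text \<open>In dimension one, the Ricci form is \<open>- \<i>\<partial>\<partial>\<close>-bar \<open>log \<omega>\<close>, and the trace of a form is its
  quotient by \<open>\<omega>\<close>.\<close>

definition curve_scalar_curvature :: "complex form2 \<Rightarrow> complex \<Rightarrow> real" where
  "curve_scalar_curvature \<omega> z = - iddbar (\<lambda>x. ln (\<omega> x 1 \<i>)) z 1 \<i> / \<omega> z 1 \<i>"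

text \<open>A line bundle is given by its total space, its projection and local trivializations
  \<open>(V, \<psi>)\<close>, where \<open>\<psi>\<close> is the fibre coordinate.  The vector space structure of the fibres and
  the holomorphic structure are the ones induced by the trivializations.\<close>

record ('a, 'e) line_bundle =
  total :: "'e set"
  bproj :: "'e \<Rightarrow> 'a"
  trivs :: "('a set \<times> ('e \<Rightarrow> complex)) set"

definition holomorphic_line_bundle ::
    "'a topology \<Rightarrow> ('a, complex) chart set \<Rightarrow> ('a, 'e) line_bundle \<Rightarrow> bool" where
  "holomorphic_line_bundle T A L \<longleftrightarrow>
     bproj L ` total L = topspace T \<and>
     \<Union>(fst ` trivs L) = topspace T \<and>
     (\<forall>(V, \<psi>)\<in>trivs L. openin T V \<and>
        (\<forall>x\<in>V. bij_betw \<psi> {e \<in> total L. bproj L e = x} UNIV)) \<and>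
     (\<forall>(V, \<psi>)\<in>trivs L. \<forall>(V', \<psi>')\<in>trivs L. \<exists>g.
        (\<forall>x\<in>V \<inter> V'. g x \<noteq> 0) \<and>
        (\<forall>\<kappa>\<in>A. (g \<circ> chart_inv \<kappa>) holomorphic_on snd \<kappa> ` (fst \<kappa> \<inter> (V \<inter> V'))) \<and>
        (\<forall>e\<in>total L. bproj L e \<in> V \<inter> V' \<longrightarrow> \<psi>' e = g (bproj L e) * \<psi> e))"

text \<open>A Hermitian metric is given by its local functions \<open>h\<close>: in the trivialization
  \<open>t = (V, \<psi>)\<close>, the norm squared of \<open>e\<close> is \<open>h t x * (cmod (\<psi> e))\<^sup>2\<close>, with \<open>x\<close> the base
  point of \<open>e\<close>.\<close>

type_synonym ('a, 'e) local_norms = "'a set \<times> ('e \<Rightarrow> complex) \<Rightarrow> 'a \<Rightarrow> real"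

definition hermitian_metric ::
    "('a, complex) chart set \<Rightarrow> ('a, 'e) line_bundle \<Rightarrow> ('a, 'e) local_norms \<Rightarrow> bool" where
  "hermitian_metric A L h \<longleftrightarrow>
     (\<forall>t\<in>trivs L. (\<forall>x\<in>fst t. h t x > 0) \<and>
        (\<forall>\<kappa>\<in>A. Cinf_on (snd \<kappa> ` (fst \<kappa> \<inter> fst t)) (h t \<circ> chart_inv \<kappa>))) \<and>
     (\<forall>t\<in>trivs L. \<forall>t'\<in>trivs L. \<forall>e\<in>total L. bproj L e \<in> fst t \<inter> fst t' \<longrightarrow>
        h t (bproj L e) * (cmod (snd t e))\<^sup>2 = h t' (bproj L e) * (cmod (snd t' e))\<^sup>2)"

text \<open>The curvature form \<open>- \<i>\<partial>\<partial>\<close>-bar \<open>log h\<close>; it does not depend on the trivialization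
  used.\<close>

definition bundle_curvature ::
    "('a, 'e) line_bundle \<Rightarrow> ('a, 'e) local_norms \<Rightarrow> ('a, complex) chart \<Rightarrow> complex form2" where
  "bundle_curvature L h \<kappa> y u v =
     (let t = (SOME t. t \<in> trivs L \<and> chart_inv \<kappa> y \<in> fst t)
      in - iddbar (\<lambda>z. ln (h t (chart_inv \<kappa> z))) y u v)"

text \<open>The degree as the integral of the first Chern form of any Hermitian metric.\<close>

definition has_degree :: "('a, complex) chart set \<Rightarrow> ('a, 'e) line_bundle \<Rightarrow> int \<Rightarrow> bool" where
  "has_degree A L d \<longleftrightarrow>
     (\<forall>h. hermitian_metric A L h \<longrightarrow>
        form_integral A (\<lambda>\<kappa> y. bundle_curvature L h \<kappa> y 1 \<i>) = 2 * pi * of_int d)"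


section \<open>The projective bundle of the sum of a line bundle and the trivial bundle\<close>

text \<open>\<open>bline L e c\<close> is the subspace of \<open>L\<^sub>x \<oplus> \<complex>\<close> generated by \<open>(e, c)\<close>, with \<open>x\<close> the base point
  of \<open>e\<close>.\<close>

definition bline :: "('a, 'e) line_bundle \<Rightarrow> 'e \<Rightarrow> complex \<Rightarrow> ('e \<times> complex) set" where
  "bline L e c = {(e', c'). e' \<in> total L \<and> bproj L e' = bproj L e \<and>
     (\<exists>\<mu>. c' = \<mu> * c \<and> (\<forall>(V, \<psi>)\<in>trivs L. bproj L e \<in> V \<longrightarrow> \<psi> e' = \<mu> * \<psi> e))}"

definition is_zero_vector :: "('a, 'e) line_bundle \<Rightarrow> 'e \<Rightarrow> bool" where
  "is_zero_vector L e \<longleftrightarrow> (\<forall>(V, \<psi>)\<in>trivs L. bproj L e \<in> V \<longrightarrow> \<psi> e = 0)"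

definition proj_bundle :: "('a, 'e) line_bundle \<Rightarrow> ('e \<times> complex) set set" where
  "proj_bundle L = {bline L e c | e c. e \<in> total L \<and> \<not> (is_zero_vector L e \<and> c = 0)}"

definition base_point :: "('a, 'e) line_bundle \<Rightarrow> ('e \<times> complex) set \<Rightarrow> 'a" where
  "base_point L l = (THE x. \<forall>(e, c)\<in>l. bproj L e = x)"

definition infinity_divisor :: "('a, 'e) line_bundle \<Rightarrow> ('e \<times> complex) set set" where
  "infinity_divisor L = {l \<in> proj_bundle L. \<forall>(e, c)\<in>l. c = 0}"

definition ruling_fibre :: "('a, 'e) line_bundle \<Rightarrow> 'a \<Rightarrow> ('e \<times> complex) set set" where
  "ruling_fibre L x = {l \<in> proj_bundle L. base_point L l = x}"

text \<open>Coordinates \<open>(z, w)\<close> on the complement of the infinity divisor, where \<open>w\<close> is the fibre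
  coordinate of \<open>L\<close> and a vector \<open>e\<close> of \<open>L\<close> is identified with the line generated by
  \<open>(e, 1)\<close>.\<close>

definition zero_chart ::
    "('a, 'e) line_bundle \<Rightarrow> ('a, complex) chart \<Rightarrow> ('a set \<times> ('e \<Rightarrow> complex)) \<Rightarrow>
     (('e \<times> complex) set, complex^2) chart" where
  "zero_chart L \<kappa> t =
     ({l \<in> proj_bundle L. base_point L l \<in> fst \<kappa> \<inter> fst t \<and> (\<exists>(e, c)\<in>l. c \<noteq> 0)},
      \<lambda>l. vector [snd \<kappa> (base_point L l), THE w. \<forall>(e, c)\<in>l. snd t e = w * c])"

text \<open>Coordinates \<open>(z, 1/w)\<close> on the complement of the zero divisor.\<close>

definition infinity_chart ::
    "('a, 'e) line_bundle \<Rightarrow> ('a, complex) chart \<Rightarrow> ('a set \<times> ('e \<Rightarrow> complex)) \<Rightarrow>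
     (('e \<times> complex) set, complex^2) chart" where
  "infinity_chart L \<kappa> t =
     ({l \<in> proj_bundle L. base_point L l \<in> fst \<kappa> \<inter> fst t \<and> (\<exists>(e, c)\<in>l. snd t e \<noteq> 0)},
      \<lambda>l. vector [snd \<kappa> (base_point L l), THE w. \<forall>(e, c)\<in>l. c = w * snd t e])"

definition ruled_atlas ::
    "('a, complex) chart set \<Rightarrow> ('a, 'e) line_bundle \<Rightarrow> (('e \<times> complex) set, complex^2) chart set" where
  "ruled_atlas A L =
     {zero_chart L \<kappa> t | \<kappa> t. \<kappa> \<in> A \<and> t \<in> trivs L} \<union>
     {infinity_chart L \<kappa> t | \<kappa> t. \<kappa> \<in> A \<and> t \<in> trivs L}"


section \<open>Kaehler geometry of complex surfaces\<close>

text \<open>The density of the wedge product of two 2-forms with respect to Lebesgue measure, that is,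
  its value on the oriented frame \<open>e\<^sub>1, \<i> e\<^sub>1, e\<^sub>2, \<i> e\<^sub>2\<close>.\<close>

definition wedge_density :: "(complex^2) form2 \<Rightarrow> (complex^2) form2 \<Rightarrow> complex^2 \<Rightarrow> real" where
  "wedge_density \<alpha> \<beta> y =
     (let p = axis 1 1; q = axis 1 \<i>; r = axis 2 1; s = axis 2 \<i> in
      \<alpha> y p q * \<beta> y r s - \<alpha> y p r * \<beta> y q s + \<alpha> y p s * \<beta> y q r
        + \<alpha> y q r * \<beta> y p s - \<alpha> y q s * \<beta> y p r + \<alpha> y r s * \<beta> y p q)"

definition ricci_form :: "(complex^2) form2 \<Rightarrow> (complex^2) form2" where
  "ricci_form \<omega> y u v = - iddbar (\<lambda>x. ln (wedge_density \<omega> \<omega> x)) y u v"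

definition form_trace :: "(complex^2) form2 \<Rightarrow> (complex^2) form2 \<Rightarrow> complex^2 \<Rightarrow> real" where
  "form_trace \<omega> \<alpha> y = 2 * wedge_density \<alpha> \<omega> y / wedge_density \<omega> \<omega> y"

definition scalar_curvature :: "(complex^2) form2 \<Rightarrow> complex^2 \<Rightarrow> real" where
  "scalar_curvature \<omega> = form_trace \<omega> (ricci_form \<omega>)"

definition dbar :: "2 \<Rightarrow> (complex^2 \<Rightarrow> complex) \<Rightarrow> complex^2 \<Rightarrow> complex" where
  "dbar k f y =
     (frechet_derivative f (at y) (axis k 1) + \<i> * frechet_derivative f (at y) (axis k \<i>)) / 2"

text \<open>The entry \<open>g $ j $ k\<close> is the coefficient in the expression of \<open>\<omega>\<close> as the sum of
  \<open>\<i> * g $ j $ k\<close> times \<open>dz\<^sub>j \<and> cnj dz\<^sub>k\<close>.\<close>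

definition metric_matrix :: "(complex^2) form2 \<Rightarrow> complex^2 \<Rightarrow> complex^2^2" where
  "metric_matrix \<omega> y =
     (\<chi> j k. Complex (\<omega> y (axis j 1) (axis k \<i>) / 2) (- \<omega> y (axis j 1) (axis k 1) / 2))"

text \<open>The transpose appears because the coefficients of the inverse metric \<open>H\<close>, with the barred
  index second, satisfy \<open>(\<Sum>k. H $ j $ k * g $ l $ k) = (if j = l then 1 else 0)\<close>.\<close>

definition grad10 :: "(complex^2) form2 \<Rightarrow> (complex^2 \<Rightarrow> real) \<Rightarrow> complex^2 \<Rightarrow> complex^2" where
  "grad10 \<omega> f y =
     matrix_inv (transpose (metric_matrix \<omega> y)) *v (\<chi> k. dbar k (\<lambda>x. complex_of_real (f x)) y)"

definition coupled_extremal ::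
    "('p, complex^2) chart set \<Rightarrow> (('p, complex^2) chart \<Rightarrow> (complex^2) form2) \<Rightarrow>
     (('p, complex^2) chart \<Rightarrow> (complex^2) form2) \<Rightarrow> bool" where
  "coupled_extremal A \<omega> \<omega>' \<longleftrightarrow>
     kaehler_form A \<omega> \<and> kaehler_form A \<omega>' \<and>
     (\<forall>\<kappa>\<in>A. \<forall>y\<in>chart_image \<kappa>.
        (\<forall>u v. ricci_form (\<omega> \<kappa>) y u v = ricci_form (\<omega>' \<kappa>) y u v) \<and>
        (\<forall>j k. dbar k (\<lambda>x. grad10 (\<omega> \<kappa>)
            (\<lambda>x. scalar_curvature (\<omega> \<kappa>) x
                   - form_trace (\<omega> \<kappa>) (\<lambda>x u v. \<omega> \<kappa> x u v + \<omega>' \<kappa> x u v) x) x $ j) y = 0))"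


section \<open>Kaehler classes and the Calabi ansatz on the ruled surface\<close>

text \<open>The charts induced by the \<open>j\<close>-th coordinate on a complex curve \<open>S\<close> in a complex surface,
  for curves on which the other coordinate is constant.\<close>

definition curve_atlas ::
    "('p, complex^2) chart set \<Rightarrow> 'p set \<Rightarrow> 2 \<Rightarrow> ('p, complex) chart set" where
  "curve_atlas A S j = (\<lambda>\<kappa>. (fst \<kappa> \<inter> S, \<lambda>x. snd \<kappa> x $ j)) ` A"

text \<open>The pullback of a 2-form by the inclusion of a curve, in the chart \<open>\<sigma>\<close> of the curve.\<close>

definition restrict_form ::
    "('p, complex^2) chart set \<Rightarrow> (('p, complex^2) chart \<Rightarrow> (complex^2) form2) \<Rightarrow>
     ('p, complex) chart \<Rightarrow> complex form2" where
  "restrict_form A \<beta> \<sigma> z u v =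
     (let \<kappa> = (SOME \<kappa>. \<kappa> \<in> A \<and> chart_inv \<sigma> z \<in> fst \<kappa>);
          F = snd \<kappa> \<circ> chart_inv \<sigma>;
          D = frechet_derivative F (at z)
      in \<beta> \<kappa> (F z) (D u) (D v))"

definition poincare_dual ::
    "('p, complex^2) chart set \<Rightarrow> 'p set \<Rightarrow> 2 \<Rightarrow> (('p, complex^2) chart \<Rightarrow> (complex^2) form2) \<Rightarrow> bool" where
  "poincare_dual A S j \<eta> \<longleftrightarrow> closed_two_form A \<eta> \<and>
     (\<forall>\<beta>. closed_two_form A \<beta> \<longrightarrow>
        form_integral A (\<lambda>\<kappa>. wedge_density (\<eta> \<kappa>) (\<beta> \<kappa>)) =
        form_integral (curve_atlas A S j) (\<lambda>\<sigma> z. restrict_form A \<beta> \<sigma> z 1 \<i>))"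

text \<open>The closed 2-forms whose de Rham class is \<open>2\<pi>(C + a D)\<close>, where \<open>C\<close> is the Poincare dual
  of a fibre and \<open>D\<close> that of the infinity divisor.\<close>

definition Omega_class ::
    "('a, complex) chart set \<Rightarrow> ('a, 'e) line_bundle \<Rightarrow> real \<Rightarrow>
     ((('e \<times> complex) set, complex^2) chart \<Rightarrow> (complex^2) form2) set" where
  "Omega_class A L a =
     {\<omega>. closed_two_form (ruled_atlas A L) \<omega> \<and>
        (\<exists>x\<in>\<Union>(fst ` A). \<exists>\<eta>C \<eta>D \<theta>.
           poincare_dual (ruled_atlas A L) (ruling_fibre L x) 2 \<eta>C \<and>
           poincare_dual (ruled_atlas A L) (infinity_divisor L) 1 \<eta>D \<and>
           smooth_one_form (ruled_atlas A L) \<theta> \<and>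
           (\<forall>\<kappa>\<in>ruled_atlas A L. \<forall>y\<in>chart_image \<kappa>. \<forall>u v.
              \<omega> \<kappa> y u v - 2 * pi * (\<eta>C \<kappa> y u v + a * \<eta>D \<kappa> y u v) = ext_deriv1 (\<theta> \<kappa>) y u v))}"

text \<open>The logarithm of the fibrewise norm squared, in the coordinates of
  \<^term>\<open>zero_chart L \<kappa> t\<close>.\<close>

definition log_norm ::
    "('a, 'e) local_norms \<Rightarrow> ('a, complex) chart \<Rightarrow> ('a set \<times> ('e \<Rightarrow> complex)) \<Rightarrow> complex^2 \<Rightarrow> real" where
  "log_norm h \<kappa> t y = ln (h t (chart_inv \<kappa> (y $ 1))) + ln ((cmod (y $ 2))\<^sup>2)"

text \<open>The complement of the zero and infinity divisors is covered by the parts \<open>w \<noteq> 0\<close> of the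
  charts \<^term>\<open>zero_chart L \<kappa> t\<close>.  Smooth extension to the whole surface is part of
  \<^term>\<open>kaehler_form (ruled_atlas A L) \<omega>\<close>.\<close>

definition calabi_ansatz ::
    "('a, complex) chart set \<Rightarrow> ('a, 'e) line_bundle \<Rightarrow> ('a, 'e) local_norms \<Rightarrow>
     (('a, complex) chart \<Rightarrow> complex form2) \<Rightarrow> real \<Rightarrow>
     ((('e \<times> complex) set, complex^2) chart \<Rightarrow> (complex^2) form2) \<Rightarrow> bool" where
  "calabi_ansatz A L h \<omega>\<Sigma> a \<omega> \<longleftrightarrow>
     kaehler_form (ruled_atlas A L) \<omega> \<and> \<omega> \<in> Omega_class A L a \<and>
     (\<exists>f::real \<Rightarrow> real.
        Cinf_on UNIV f \<and> strictly_convex f \<and> strict_mono (\<lambda>s. s + f s) \<and>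
        (deriv f \<longlongrightarrow> 0) at_bot \<and> (deriv f \<longlongrightarrow> a) at_top \<and>
        (\<forall>\<kappa>\<in>A. \<forall>t\<in>trivs L. \<forall>y\<in>chart_image (zero_chart L \<kappa> t). y $ 2 \<noteq> 0 \<longrightarrow>
           (\<forall>u v. \<omega> (zero_chart L \<kappa> t) y u v =
              \<omega>\<Sigma> \<kappa> (y $ 1) (u $ 1) (v $ 1) + iddbar (\<lambda>x. f (log_norm h \<kappa> t x)) y u v)))"

definition vartheta :: "real \<Rightarrow> real" where
  "vartheta x = 9 * x ^ 4 - 88 * x ^ 3 - 280 * x ^ 2 - 240 * x - 48"

end

theory Submission
  imports Defs "HOL-Complex_Analysis.Cauchy_Integral_Formula" "HOL-Real_Asymp.Real_Asymp"
begin

text \<open>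
  Write \<open>u\<close> for the momentum \<open>f'\<close> of \<open>\<omega>\<close>, \<open>v\<close> for that of \<open>\<chi>\<close>, and \<open>x = 1 + u\<close>,
  \<open>m = 1 + a\<close>.  Equality of the Ricci forms makes \<open>(1 + v) v'\<close> a constant multiple of \<open>x u'\<close>,
  and the second equation makes \<open>R(\<omega>) - \<Lambda>\<chi>\<close> an affine function of \<open>u\<close>.  Integrating twice,
  \<open>x u' + e = p(x)\<close> with a quartic \<open>p\<close> whose coefficient of \<open>x\<^sup>2\<close> is \<open>-3/2\<close> and an error
  \<open>e \<ge> 0\<close> of size \<open>O(b)\<close>.  The smooth extension over the two divisors gives
  \<open>p(1) = 0\<close>, \<open>p'(1) = 1\<close>, \<open>p(m) = O(b)\<close>, \<open>p'(m) = -m + m b\<close>, which determines \<open>p\<close>.  For \<open>b = 0\<close>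
  it is \<open>(x - 1)(m - x)\<close> times a quadratic of discriminant proportional to \<open>\<vartheta>(a)\<close> with a
  negative value at \<open>\<surd>m\<close> as soon as \<open>a > k\<^sub>0\<close>; this contradicts \<open>x u' > 0\<close> for small \<open>b\<close>.
\<close>

section \<open>The quartic momentum profile\<close>

text \<open>The Ricci equation integrates to (1 + v)^2 = c x^2 + const, so v is a square root in x
  and x u' itself is not a polynomial in x. This forces the splitting: e is the integral of v x dx
  and collects all non-polynomial dependence, so that only p = x u' + e is a quartic. The second
  metric reaches the coefficients of p through two numbers alone, the end value of e and the slope
  correction m b, both O(b). Between the ends only the sign of e enters, and it is favourable: x u'
  > 0 and e \<ge> 0 give p > 0 on the whole range of x. The coefficient -3/2 integrates -3x, of
  which 2x comes from the curvature -2 of the base and x from the constant 1 in 1 + v. The slopes 1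
  and -m say that u' behaves like the squared fibre coordinate near each divisor, so that u''/u'
  tends to 1 and to -1.\<close>

lemma vartheta_root:
  "\<exists>k0>0. vartheta k0 = 0 \<and> (\<forall>x>0. vartheta x = 0 \<longrightarrow> x = k0) \<and> \<bar>k0 - 12.451\<bar> < 0.0005 \<and>
     (\<forall>x>k0. vartheta x > 0)"
proof -
  \<comment> \<open>The bracket is 12.451 with the tolerance 0.0005 on either side; strict signs at
    its ends later exclude them as roots.\<close>
  have neg: "vartheta 12.4505 < 0" and pos: "vartheta 12.4515 > 0"
    by (simp_all add: vartheta_def power_numeral_even power_numeral_odd)
  have "\<forall>x::real. 12.4505 \<le> x \<and> x \<le> 12.4515 \<longrightarrow> isCont vartheta x"
    by (auto simp: vartheta_def[abs_def] intro!: continuous_intros)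
  then obtain k0 where k0: "12.4505 \<le> k0" "k0 \<le> 12.4515" "vartheta k0 = 0"
    using IVT[of vartheta "12.4505" 0 "12.4515"] neg pos by fastforce
  have "12.4505 < k0" "k0 < 12.4515" using k0 neg pos by (metis order_le_less less_irrefl)+
  then have "k0 < 12.451 + 0.0005" "12.451 - 0.0005 < k0" by simp_all
  then have close: "\<bar>k0 - 12.451\<bar> < 0.0005" unfolding abs_less_iff by auto
  \<comment> \<open>Only the leading coefficient is positive. Division by x^4 therefore leaves 9
    minus a strictly decreasing function, which gives uniqueness and the sign beyond
    \<open>k0\<close> at once.\<close>
  define \<rho> where "\<rho> x = 88 / x + 280 / x ^ 2 + 240 / x ^ 3 + 48 / x ^ 4" for x :: real
  have fac: "vartheta x = x ^ 4 * (9 - \<rho> x)" if "x > 0" for x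
    using that by (simp add: vartheta_def \<rho>_def field_simps power_numeral_even power_numeral_odd)
  have anti: "\<rho> y < \<rho> x" if "0 < x" "x < y" for x y
    unfolding \<rho>_def using that
    by (intro add_strict_mono divide_strict_left_mono power_strict_mono mult_pos_pos zero_less_power) auto
  have kpos: "k0 > 0" using k0 by simp
  have \<rho>0: "\<rho> k0 = 9" using fac[OF kpos] k0(3) kpos by simp
  have uniq: "x = k0" if "x > 0" "vartheta x = 0" for x
  proof -
    have "\<rho> x = 9" using fac[OF that(1)] that by simp
    then show ?thesis using anti[of x k0] anti[of k0 x] kpos that(1) \<rho>0
      by (metis less_irrefl linorder_neqE_linordered_idom)
  qed
  have "vartheta x > 0" if "x > k0" for x
    using fac[of x] anti[OF kpos that] \<rho>0 that kpos by simp
  then show ?thesis using kpos k0(3) uniq close by blast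
qed

text \<open>Here \<open>C, D, -3/2, B, A\<close> are the coefficients of the quartic and \<open>e\<close>, \<open>b\<close> the perturbations.
  The test point is the geometric mean of the roots \<open>1\<close> and \<open>1 + a\<close>, because the remaining
  quadratic factor has the product of its roots equal to \<open>1 + a\<close>.\<close>

lemma quartic_negative_at_geometric_mean:
  fixes a :: real
  assumes a: "12 < a" "vartheta a > 0"
  defines "r \<equiv> sqrt (1 + a)"
  shows "\<exists>\<delta>>0. \<forall>b e A B C D. 0 < b \<and> b < \<delta> \<and> 0 \<le> e \<and> e \<le> b * ((1 + a)\<^sup>2 - 1) / 2 \<and>
     C + D - 3/2 + B + A = 0 \<and> D - 3 + 3 * B + 4 * A = 1 \<and>
     C + D * (1 + a) - 3/2 * (1 + a)^2 + B * (1 + a)^3 + A * (1 + a)^4 = e \<and>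
     D - 3 * (1 + a) + 3 * B * (1 + a)^2 + 4 * A * (1 + a)^3 = - (1 + a) + (1 + a) * b \<longrightarrow>
     C + D * r - 3/2 * r^2 + B * r^3 + A * r^4 < 0"
proof -
  define m where "m = 1 + a"
  define n where "n = m - 1"
  \<comment> \<open>The y^2 coefficient of (y - 1)^2 (y - m)^2, hence the factor of \<open>A\<close>
    when the prescribed coefficient -3/2 is solved for \<open>A\<close>.\<close>
  define \<Delta> where "\<Delta> = m^2 + 4 * m + 1"
  have m: "m > 13" "a = m - 1" using a by (auto simp: m_def)
  have n: "n > 0" using m n_def by simp
  have \<Delta>: "\<Delta> > 0" using m by (simp add: \<Delta>_def add_pos_pos)
  have r2: "r^2 = m" "r > 1" using a by (simp_all add: r_def m_def)
  \<comment> \<open>The value at r of the quartic for b = e = 0, in Hermite form with double nodes 1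
    and m: there k = c = -1/n and A = -(5m - 1) / (2 n \<Delta>).\<close>
  define \<psi> where "\<psi> = (r - 1) - (r - 1)^2 * (1 + r - m) / n - (5*m - 1) / (2 * n * \<Delta>) * (r - 1)^2 * (r - m)^2"
  have disc: "4 * m * (5*m - 1)^2 < (3*m^2 - 4*m - 3)^2"
  proof -
    have "vartheta a = (3*m^2 - 4*m - 3)^2 - 4 * m * (5*m - 1)^2"
      unfolding vartheta_def m(2) by (simp add: power2_eq_square power3_eq_cube power4_eq_xxxx algebra_simps)
    then show ?thesis using a by simp
  qed
  \<comment> \<open>The bound a > 12 serves to make 3m^2 - 4m - 3 nonnegative, so that the
    comparison of squares in \<open>disc\<close> can be undone.\<close>
  have "13 * m < m * m" using m by (intro mult_strict_right_mono) auto
  then have "0 \<le> 3*m^2 - 4*m - 3" using m unfolding power2_eq_square by linarith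
  moreover have "(2 * r * (5*m - 1))^2 < (3*m^2 - 4*m - 3)^2"
    using disc r2 by (simp add: power_mult_distrib)
  ultimately have main: "2 * r * (5*m - 1) < 3*m^2 - 4*m - 3"
    by (rule power_less_imp_less_base[rotated])
  \<comment> \<open>Substituting m = r^2 leaves a polynomial identity in r. The last factor is, up
    to positive factors, the value of the quadratic cofactor at the geometric mean.\<close>
  have "2 * n * \<Delta> * \<psi> = r^2 * (r - 1)^2 * (2 * r * (5*m - 1) - (3*m^2 - 4*m - 3))"
  proof -
    have "2 * n * \<Delta> * \<psi> = 2 * n * \<Delta> * (r - 1) - 2 * \<Delta> * (r - 1)^2 * (1 + r - m) - (5*m - 1) * (r - 1)^2 * (r - m)^2"
      using n \<Delta> unfolding \<psi>_def by (simp add: field_simps)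
    also have "\<dots> = r^2 * (r - 1)^2 * (2 * r * (5*m - 1) - (3*m^2 - 4*m - 3))"
      unfolding n_def \<Delta>_def r2(1)[symmetric] by (simp add: power2_eq_square algebra_simps)
    finally show ?thesis .
  qed
  also have "\<dots> < 0" using main r2(2) by (intro mult_pos_neg mult_pos_pos) auto
  finally have \<psi>neg: "\<psi> < 0" using n \<Delta> by (simp add: mult_less_0_iff)
  \<comment> \<open>The value at r is affine in e and b; \<open>P\<close> and \<open>Q\<close> are
    the coefficients of e and b. The bound on e merges both into one error of size at most b
    \<open>K\<close>.\<close>
  define P where "P = (r - 1)^2 * (1 / n^2 - 2 / n^3 * (r - m) + (- 2 / n^3 * (m + 2) - 1 / n^2) / \<Delta> * (r - m)^2)"
  define Q where "Q = (r - 1)^2 * (m / n^2 * (r - m) + m / n^2 * (m + 2) / \<Delta> * (r - m)^2)"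
  define K where "K = \<bar>P\<bar> * ((m^2 - 1) / 2) + \<bar>Q\<bar>"
  have K: "K \<ge> 0" using m by (auto simp: K_def intro!: add_nonneg_nonneg mult_nonneg_nonneg)
  \<comment> \<open>Dividing by \<open>K + 1\<close> keeps the denominator positive when
    \<open>K\<close> is 0.\<close>
  define \<delta> where "\<delta> = - \<psi> / (K + 1)"
  have \<delta>: "\<delta> > 0" using \<psi>neg K unfolding \<delta>_def by (intro divide_pos_pos) auto
  have key: "C + D * r - 3/2 * r^2 + B * r^3 + A * r^4 < 0"
    if b: "0 < b" "b < \<delta>" and e: "0 \<le> e" "e \<le> b * (m\<^sup>2 - 1) / 2"
     and h: "C + D - 3/2 + B + A = 0" "D - 3 + 3 * B + 4 * A = 1"
     "C + D * m - 3/2 * m^2 + B * m^3 + A * m^4 = e"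
     "D - 3 * m + 3 * B * m^2 + 4 * A * m^3 = - m + m * b" for b e A B C D
  proof -
    \<comment> \<open>The two conditions at 1 give the form (y - 1) + (y - 1)^2 q(y) with q
      quadratic and leading coefficient \<open>A\<close>; \<open>k\<close> and \<open>c\<close> are
      the value and the derivative of q at m. The two conditions at m determine them, and the
      coefficient -3/2 then determines \<open>A\<close>.\<close>
    define k where "k = A * m^2 + (B + 2 * A) * m + (- 3/2 + 2 * B + 3 * A)"
    define c where "c = 2 * A * m + (B + 2 * A)"
    have D: "D = 4 - 3 * B - 4 * A" and C: "C = 3/2 - B - A - D" using h by linarith+
    have k: "n + n^2 * k = e"
      using h(3) unfolding C D n_def k_def by (simp add: power2_eq_square power3_eq_cube power4_eq_xxxx algebra_simps)
    have c: "1 + 2 * n * k + n^2 * c = - m + m * b"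
      using h(4) unfolding C D n_def k_def c_def by (simp add: power2_eq_square power3_eq_cube power4_eq_xxxx algebra_simps)
    have A: "- 3/2 = k - c * (m + 2) + A * \<Delta>"
      unfolding k_def c_def \<Delta>_def by (simp add: power2_eq_square algebra_simps)
    have k': "k = (e - n) / n^2" using k n by (simp add: field_simps)
    have c': "c = (- m + m * b - 1 - 2 * n * k) / n^2" using c n by (simp add: field_simps)
    have A': "A = (- 3/2 - k + c * (m + 2)) / \<Delta>" using A \<Delta> by (simp add: field_simps)
    have c'': "c = (1 - m) / n^2 + m * b / n^2 - 2 * e / n^3"
      unfolding c' k' using n by (simp add: field_simps power2_eq_square power3_eq_cube)
    have k'': "k = - 1 / n + e / n^2" unfolding k' using n by (simp add: field_simps power2_eq_square)
    have c3: "c = - 1 / n + m * b / n^2 - 2 * e / n^3"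
    proof -
      have "1 - m = - n" by (simp add: n_def)
      then show ?thesis unfolding c'' using n by (simp add: power2_eq_square)
    qed
    have A'': "A = - (5*m - 1) / (2 * n * \<Delta>) + ((m * b / n^2 - 2 * e / n^3) * (m + 2) - e / n^2) / \<Delta>"
    proof -
      have "(- 3/2 + 1 / n - 1 / n * (m + 2)) = - (5*m - 1) / (2 * n)"
      proof -
        have "m = n + 1" by (simp add: n_def)
        then show ?thesis using n by (simp add: field_simps)
      qed
      moreover have "- 3/2 - k + c * (m + 2) = (- 3/2 + 1 / n - 1 / n * (m + 2)) + ((m * b / n^2 - 2 * e / n^3) * (m + 2) - e / n^2)"
        unfolding k'' c3 by (simp add: algebra_simps)
      ultimately show ?thesis unfolding A' by (simp add: add_divide_distrib)
    qed
    \<comment> \<open>The inverses become free variables, so that sorting by e and b is a plain ring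
      identity; q and t stand for (r - 1)^2 and (r - m)^2.\<close>
    have regroup: "r - 1 + q * (- 1 * i1 + e * i2 + (- 1 * i1 + m * b * i2 - 2 * e * i3) * (r - m) +
        (- (5 * m - 1) * i4 + ((m * b * i2 - 2 * e * i3) * (m + 2) - e * i2) * i5) * t) =
      r - 1 - q * (1 + r - m) * i1 - (5 * m - 1) * i4 * q * t +
        (e * (q * (1 * i2 - 2 * i3 * (r - m) + (- 2 * i3 * (m + 2) - 1 * i2) * i5 * t)) +
         b * (q * (m * i2 * (r - m) + m * i2 * (m + 2) * i5 * t)))" for q i1 i2 i3 i4 i5 t :: real
      by (simp add: algebra_simps)
    have "C + D * r - 3/2 * r^2 + B * r^3 + A * r^4 =
       (r - 1) + (r - 1)^2 * (k + c * (r - m) + A * (r - m)^2)"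
      unfolding C D k_def c_def by (simp add: power2_eq_square power3_eq_cube power4_eq_xxxx algebra_simps)
    also have "\<dots> = \<psi> + (e * P + b * Q)"
      unfolding \<psi>_def P_def Q_def k'' c3 A''
      unfolding divide_inverse by (rule regroup)
    also have "\<dots> \<le> \<psi> + b * K"
    proof -
      have "e * P \<le> e * \<bar>P\<bar>" using e by (intro mult_left_mono) auto
      also have "\<dots> \<le> (b * (m\<^sup>2 - 1) / 2) * \<bar>P\<bar>" using e by (intro mult_right_mono) auto
      finally have "e * P \<le> b * (\<bar>P\<bar> * ((m^2 - 1) / 2))" by (simp add: algebra_simps)
      moreover have "b * Q \<le> b * \<bar>Q\<bar>" using b by (intro mult_left_mono) auto
      ultimately have "e * P + b * Q \<le> b * (\<bar>P\<bar> * ((m^2 - 1) / 2)) + b * \<bar>Q\<bar>" by (rule add_mono)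
      then show ?thesis unfolding K_def distrib_left by simp
    qed
    also have "\<dots> < 0"
    proof -
      have "b * (K + 1) < - \<psi>" using b(2) K unfolding \<delta>_def by (subst (asm) pos_less_divide_eq) auto
      then show ?thesis using b(1) by (simp add: algebra_simps)
    qed
    finally show ?thesis .
  qed
  show ?thesis using \<delta> key unfolding m_def by blast
qed

section \<open>Monotone functions on the line, and integration of the momentum equations\<close>

lemma DERIV_zero_const:
  fixes f :: "real \<Rightarrow> real"
  assumes "\<And>s. (f has_real_derivative 0) (at s)"
  shows "f s = f t"
  using DERIV_isconst_all[of f s t] assms by blast

lemma limit_at_bot_le:
  fixes g :: "real \<Rightarrow> real"
  assumes "\<And>s. (g has_real_derivative g' s) (at s)" "\<And>s. g' s \<ge> 0" "(g \<longlongrightarrow> l) at_bot"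
  shows "l \<le> g s"
proof (rule tendsto_upperbound[OF assms(3)])
  show "\<forall>\<^sub>F x in at_bot. g x \<le> g s"
    using eventually_le_at_bot[of s]
    by eventually_elim (meson DERIV_nonneg_imp_nondecreasing assms)
qed simp

lemma limit_at_top_ge:
  fixes g :: "real \<Rightarrow> real"
  assumes "\<And>s. (g has_real_derivative g' s) (at s)" "\<And>s. g' s \<ge> 0" "(g \<longlongrightarrow> l) at_top"
  shows "g s \<le> l"
proof (rule tendsto_lowerbound[OF assms(3)])
  show "\<forall>\<^sub>F x in at_top. g s \<le> g x"
    using eventually_ge_at_top[of s]
    by eventually_elim (meson DERIV_nonneg_imp_nondecreasing assms)
qed simp

lemma limit_at_bot_less:
  fixes g :: "real \<Rightarrow> real"
  assumes "\<And>s. (g has_real_derivative g' s) (at s)" "\<And>s. g' s > 0" "(g \<longlongrightarrow> l) at_bot"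
  shows "l < g s"
proof -
  have "l \<le> g (s - 1)" using assms limit_at_bot_le less_imp_le by metis
  also have "g (s - 1) < g s" using DERIV_pos_imp_increasing[of "s - 1" s g] assms by force
  finally show ?thesis .
qed

text \<open>Both integrations use x = 1 + u as independent variable, which u1 > 0 permits.
  Multiplied by x u1, the equation \<open>ext\<close> becomes an exact derivative; moreover x L1 is
  the x-derivative of x u1, and \<open>ric\<close> makes the remaining term x v integrable in closed
  form.\<close>

lemma momentum_profile_quartic:
  fixes u u1 u2 v v1 L1 L2 :: "real \<Rightarrow> real"
  assumes du: "\<And>s. (u has_real_derivative u1 s) (at s)"
    and du1: "\<And>s. (u1 has_real_derivative u2 s) (at s)"
    and dv: "\<And>s. (v has_real_derivative v1 s) (at s)"
    and pos: "\<And>s. u1 s > 0" "\<And>s. v1 s > 0"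
    and L1: "\<And>s. L1 s = u1 s / (1 + u s) + u2 s / u1 s"
    and dL1: "\<And>s. (L1 has_real_derivative L2 s) (at s)"
    and ric: "\<And>s. (1 + v s) * v1 s = c * ((1 + u s) * u1 s)"
    and ext: "\<And>s. - (L1 s + 2) / (1 + u s) - L2 s / u1 s - ((1 + v s) / (1 + u s) + v1 s / u1 s)
                   = \<alpha> * u s + \<beta>"
    and u_lim: "(u \<longlongrightarrow> 0) at_bot" "(u \<longlongrightarrow> a) at_top"
    and v_lim: "(v \<longlongrightarrow> 0) at_bot" "(v \<longlongrightarrow> b) at_top"
    and u1_lim: "(u1 \<longlongrightarrow> 0) at_bot" "(u1 \<longlongrightarrow> 0) at_top"
    and q_lim: "((\<lambda>s. u2 s / u1 s) \<longlongrightarrow> 1) at_bot" "((\<lambda>s. u2 s / u1 s) \<longlongrightarrow> - 1) at_top"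
  shows "\<exists>A B C D e. 0 \<le> e \<and> e \<le> b * ((1 + a)\<^sup>2 - 1) / 2 \<and>
     C + D - 3/2 + B + A = 0 \<and> D - 3 + 3 * B + 4 * A = 1 \<and>
     C + D * (1 + a) - 3/2 * (1 + a)^2 + B * (1 + a)^3 + A * (1 + a)^4 = e \<and>
     D - 3 * (1 + a) + 3 * B * (1 + a)^2 + 4 * A * (1 + a)^3 = - (1 + a) + (1 + a) * b \<and>
     (\<forall>s. 0 < C + D * (1 + u s) - 3/2 * (1 + u s)^2 + B * (1 + u s)^3 + A * (1 + u s)^4)"
proof -
  have u: "u s > 0" for s using limit_at_bot_less[OF du pos(1) u_lim(1)] .
  have v: "v s > 0" for s using limit_at_bot_less[OF dv pos(2) v_lim(1)] .
  have vb: "v s \<le> b" for s using limit_at_top_ge[OF dv _ v_lim(2)] pos(2) less_imp_le by metis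
  have x: "1 + u s > 0" for s using u[of s] by simp
  have nz [simp]: "1 + u s \<noteq> 0" "u1 s \<noteq> 0" for s using x[of s] pos(1)[of s] by simp_all
  have c: "c > 0"
  proof -
    have "0 < (1 + v 0) * v1 0" "(1 + u 0) * u1 0 > 0" using u v pos x by (simp_all add: add_pos_pos)
    then show ?thesis using ric[of 0] by (metis zero_less_mult_pos2)
  qed
  \<comment> \<open>The primitive of the left-hand side of \<open>ext\<close> times (1 + u)
    u1.\<close>
  define N where "N s = - (1 + u s) * (L1 s + 2) - (1 + u s) * (1 + v s)" for s
  have dN: "(N has_real_derivative (\<alpha> * u s + \<beta>) * (1 + u s) * u1 s) (at s)" for s
  proof -
    have "(N has_real_derivative - u1 s * (L1 s + 2) - (1 + u s) * L2 s - (u1 s * (1 + v s) + (1 + u s) * v1 s)) (at s)"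
      unfolding N_def by (auto intro!: derivative_eq_intros du dv dL1 simp: algebra_simps)
    moreover have "- u1 s * (L1 s + 2) - (1 + u s) * L2 s - (u1 s * (1 + v s) + (1 + u s) * v1 s)
        = (\<alpha> * u s + \<beta>) * (1 + u s) * u1 s"
    proof -
      have "- U * (l + 2) - X * l' - (U * w + X * w') = (- (l + 2) / X - l' / U - (w / X + w' / U)) * X * U"
        if "X \<noteq> 0" "U \<noteq> 0" for X U l l' w w' :: real using that by (simp add: field_simps)
      then show ?thesis unfolding ext[symmetric] by simp
    qed
    ultimately show ?thesis by simp
  qed
  \<comment> \<open>Normalized so that the x-integral of (\<alpha> (x - 1) + \<beta>) x is -4 A x^3
    - 3 B x^2; after the second integration \<open>A\<close> and \<open>B\<close> are the top
    coefficients of the quartic.\<close>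
  define A where "A = - \<alpha> / 12"
  define B where "B = - (\<beta> - \<alpha>) / 6"
  have N: "\<exists>D. \<forall>s. N s = - 12 * A / 3 * (1 + u s)^3 - 3 * B * (1 + u s)^2 - D"
  proof -
    define M where "M s = N s - (- 12 * A / 3 * (1 + u s)^3 - 3 * B * (1 + u s)^2)" for s
    have "(M has_real_derivative 0) (at s)" for s
      unfolding M_def
      by (auto intro!: derivative_eq_intros du dN simp: A_def B_def power2_eq_square field_simps)
    then have "M s = M 0" for s by (rule DERIV_zero_const)
    then have "\<forall>s. N s = - 12 * A / 3 * (1 + u s)^3 - 3 * B * (1 + u s)^2 - (- M 0)"
      by (simp add: M_def algebra_simps)
    then show ?thesis by blast
  qed
  then obtain D where D: "\<And>s. N s = - 4 * A * (1 + u s)^3 - 3 * B * (1 + u s)^2 - D" by auto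
  \<comment> \<open>\<open>e\<close> is chosen so that \<open>e' = x u' v\<close>, the part of the equation that is small with \<open>b\<close>\<close>
  define e where "e s = ((1 + v s)^3 - 1) / (3 * c) - ((1 + u s)^2 - 1) / 2" for s
  have de: "(e has_real_derivative (1 + u s) * u1 s * v s) (at s)" for s
  proof -
    have "(e has_real_derivative (1 + v s) * ((1 + v s) * v1 s) / c - (1 + u s) * u1 s) (at s)"
      unfolding e_def using c by (auto intro!: derivative_eq_intros du dv simp: power2_eq_square field_simps)
    moreover have "(1 + v s) * ((1 + v s) * v1 s) / c - (1 + u s) * u1 s = (1 + u s) * u1 s * v s"
      unfolding ric using c by (simp add: field_simps)
    ultimately show ?thesis by simp
  qed
  have e0: "(e \<longlongrightarrow> 0) at_bot"
  proof -
    have "(e \<longlongrightarrow> ((1 + 0)^3 - 1) / (3 * c) - ((1 + 0)^2 - 1) / 2) at_bot"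
      unfolding e_def using c by (intro tendsto_intros v_lim u_lim) auto
    then show ?thesis by simp
  qed
  define e1 where "e1 = ((1 + b)^3 - 1) / (3 * c) - ((1 + a)^2 - 1) / 2"
  have e_top: "(e \<longlongrightarrow> e1) at_top"
    unfolding e_def e1_def using c by (intro tendsto_intros v_lim u_lim) auto
  have enn: "0 \<le> e s" for s
    using limit_at_bot_le[OF de _ e0] x pos(1) v by (simp add: less_imp_le)
  have e1nn: "0 \<le> e1" using tendsto_lowerbound[OF e_top] enn by simp
  \<comment> \<open>Since v \<le> b, the derivative x u1 v of \<open>e\<close> is at most that of b
    (x^2 - 1) / 2, and both functions tend to 0 at the lower end.\<close>
  have e1b: "e1 \<le> b * ((1 + a)\<^sup>2 - 1) / 2"
  proof -
    define d where "d s = b * ((1 + u s)^2 - 1) / 2 - e s" for s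
    have dd: "(d has_real_derivative (1 + u s) * u1 s * (b - v s)) (at s)" for s
      unfolding d_def by (auto intro!: derivative_eq_intros du de simp: algebra_simps)
    have "(d \<longlongrightarrow> b * ((1 + 0)^2 - 1) / 2 - 0) at_bot"
      unfolding d_def by (intro tendsto_intros u_lim e0) auto
    then have d0: "(d \<longlongrightarrow> 0) at_bot" by simp
    have dnn: "0 \<le> d s" for s
      using limit_at_bot_le[OF dd _ d0] x pos(1) vb by (simp add: less_imp_le)
    have "(d \<longlongrightarrow> b * ((1 + a)^2 - 1) / 2 - e1) at_top"
      unfolding d_def by (intro tendsto_intros u_lim e_top) auto
    then have "0 \<le> b * ((1 + a)^2 - 1) / 2 - e1" by (rule tendsto_lowerbound) (simp_all add: dnn)
    then show ?thesis by simp
  qed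
  define p where "p y = D * y - 3/2 * y^2 + B * y^3 + A * y^4" for y :: real
  define p' where "p' y = D - 3 * y + 3 * B * y^2 + 4 * A * y^3" for y :: real
  have p'x: "p' (1 + u s) = u1 s + (1 + u s) * (u2 s / u1 s) + (1 + u s) * v s" for s
  proof -
    \<comment> \<open>Of the 3x, 2x cancels the constant in L1 + 2 and x the constant in 1 +
      v.\<close>
    have "p' (1 + u s) = - N s - 3 * (1 + u s)" unfolding p'_def D by simp
    also have "\<dots> = (1 + u s) * L1 s + (1 + u s) * v s" unfolding N_def by (simp add: algebra_simps)
    also have "(1 + u s) * L1 s = u1 s + (1 + u s) * (u2 s / u1 s)"
      unfolding L1 distrib_left by simp
    finally show ?thesis .
  qed
  \<comment> \<open>By \<open>p'x\<close>, p'(x) u1 equals (x u1)' + e', so \<open>W\<close> is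
    constant; that constant is the coefficient \<open>C\<close>.\<close>
  define W where "W s = (1 + u s) * u1 s + e s - p (1 + u s)" for s
  have "(W has_real_derivative 0) (at s)" for s
  proof -
    have "(W has_real_derivative u1 s * u1 s + (1 + u s) * u2 s + (1 + u s) * u1 s * v s - p' (1 + u s) * u1 s) (at s)"
      unfolding W_def p_def p'_def
      by (auto intro!: derivative_eq_intros du du1 de simp: algebra_simps)
    then show ?thesis unfolding p'x by (simp add: field_simps)
  qed
  then have "W s = W 0" for s by (rule DERIV_zero_const)
  then obtain C where C: "\<And>s. (1 + u s) * u1 s + e s = C + p (1 + u s)"
    by (metis W_def add.commute diff_add_cancel)
  have W_lim: "((\<lambda>s. (1 + u s) * u1 s + e s) \<longlongrightarrow> (1 + 0) * 0 + 0) at_bot"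
     "((\<lambda>s. (1 + u s) * u1 s + e s) \<longlongrightarrow> (1 + a) * 0 + e1) at_top"
    by (intro tendsto_intros u_lim u1_lim e0 e_top)+
  have p_lim: "((\<lambda>s. C + p (1 + u s)) \<longlongrightarrow> C + p (1 + 0)) at_bot"
     "((\<lambda>s. C + p (1 + u s)) \<longlongrightarrow> C + p (1 + a)) at_top"
    unfolding p_def by (intro tendsto_intros u_lim)+
  have b0: "C + p 1 = 0" using tendsto_unique[OF _ p_lim(1)] W_lim(1) C by simp
  have b1: "C + p (1 + a) = e1" using tendsto_unique[OF _ p_lim(2)] W_lim(2) C by simp
  have p'_lim: "((\<lambda>s. p' (1 + u s)) \<longlongrightarrow> p' (1 + 0)) at_bot"
     "((\<lambda>s. p' (1 + u s)) \<longlongrightarrow> p' (1 + a)) at_top"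
    unfolding p'_def by (intro tendsto_intros u_lim)+
  have q: "((\<lambda>s. u1 s + (1 + u s) * (u2 s / u1 s) + (1 + u s) * v s) \<longlongrightarrow> 0 + (1 + 0) * 1 + (1 + 0) * 0) at_bot"
     "((\<lambda>s. u1 s + (1 + u s) * (u2 s / u1 s) + (1 + u s) * v s) \<longlongrightarrow> 0 + (1 + a) * (- 1) + (1 + a) * b) at_top"
    by (intro tendsto_intros u_lim u1_lim q_lim v_lim)+
  have b2: "p' 1 = 1" using tendsto_unique[OF _ p'_lim(1)] q(1) unfolding p'x by simp
  have b3: "p' (1 + a) = - (1 + a) + (1 + a) * b" using tendsto_unique[OF _ p'_lim(2)] q(2) unfolding p'x by simp
  have "0 < C + p (1 + u s)" for s
    unfolding C[symmetric] using x[of s] pos(1)[of s] enn[of s] by (simp add: add_pos_nonneg)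
  then show ?thesis using e1nn e1b b0 b1 b2 b3 unfolding p_def p'_def
    by (intro exI[of _ A] exI[of _ B] exI[of _ C] exI[of _ D] exI[of _ e1]) (auto simp: algebra_simps)
qed

section \<open>The operator \<open>\<i>\<partial>\<partial>\<close>-bar in coordinates\<close>

text \<open>The value \<open>f'' x v w\<close> is the derivative of \<open>f' x v\<close> in the
  direction \<open>w\<close>. Carrying the derivatives as explicit functions allows the nested
  \<open>frechet_derivative\<close> in \<open>iddbar\<close> to be replaced by formulas.\<close>

definition twice_deriv ::
    "'c::real_normed_vector set \<Rightarrow> ('c \<Rightarrow> real) \<Rightarrow> ('c \<Rightarrow> 'c \<Rightarrow> real) \<Rightarrow> ('c \<Rightarrow> 'c \<Rightarrow> 'c \<Rightarrow> real) \<Rightarrow> bool" where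
  "twice_deriv S f f' f'' \<longleftrightarrow> open S \<and>
     (\<forall>x\<in>S. (f has_derivative f' x) (at x) \<and> (\<forall>v. ((\<lambda>x. f' x v) has_derivative f'' x v) (at x)))"

lemma twice_derivI:
  assumes "open S" "\<And>x. x \<in> S \<Longrightarrow> (f has_derivative f' x) (at x)"
    "\<And>x v. x \<in> S \<Longrightarrow> ((\<lambda>x. f' x v) has_derivative f'' x v) (at x)"
  shows "twice_deriv S f f' f''"
  using assms by (simp add: twice_deriv_def)

lemma twice_derivD:
  assumes "twice_deriv S f f' f''"
  shows "open S" "x \<in> S \<Longrightarrow> (f has_derivative f' x) (at x)"
    "x \<in> S \<Longrightarrow> ((\<lambda>x. f' x v) has_derivative f'' x v) (at x)"
  using assms by (auto simp: twice_deriv_def)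

lemma twice_deriv_linear:
  assumes "twice_deriv S f f' f''" "x \<in> S"
  shows "linear (f' x)" "linear (f'' x v)"
  using twice_derivD(2,3)[OF assms] has_derivative_linear by blast+

lemma has_derivative_cong_open:
  assumes "open S" "x \<in> S" "\<And>y. y \<in> S \<Longrightarrow> f y = g y"
  shows "(f has_derivative D) (at x) \<longleftrightarrow> (g has_derivative D) (at x)"
proof
  assume "(f has_derivative D) (at x)"
  then show "(g has_derivative D) (at x)"
    by (rule has_derivative_transform_within_open) (use assms in auto)
next
  assume "(g has_derivative D) (at x)"
  then show "(f has_derivative D) (at x)"
    by (rule has_derivative_transform_within_open) (use assms in auto)
qed

text \<open>Valid also where neither function is differentiable: \<open>frechet_derivative\<close>
  is a choice from the set of derivatives, and functions that agree nearby have the same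
  set.\<close>

lemma frechet_derivative_cong_open:
  assumes "open S" "x \<in> S" "\<And>y. y \<in> S \<Longrightarrow> f y = g y"
  shows "frechet_derivative f (at x) = frechet_derivative g (at x)"
  using has_derivative_cong_open[OF assms] by (simp add: frechet_derivative_def)

lemma ext_deriv1_eqI:
  assumes "((\<lambda>x. \<theta> x v) has_derivative Dv) (at y)" "((\<lambda>x. \<theta> x u) has_derivative Du) (at y)"
  shows "ext_deriv1 \<theta> y u v = Dv u - Du v"
  using assms by (simp add: ext_deriv1_def flip: frechet_derivative_at)

lemma ext_deriv1_cong_open:
  assumes "open S" "x \<in> S" "\<And>y w. y \<in> S \<Longrightarrow> \<theta> y w = \<theta>' y w"
  shows "ext_deriv1 \<theta> x u v = ext_deriv1 \<theta>' x u v"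
  unfolding ext_deriv1_def
  by (simp add: frechet_derivative_cong_open[OF assms(1,2), of "\<lambda>y. \<theta> y u" "\<lambda>y. \<theta>' y u"]
      frechet_derivative_cong_open[OF assms(1,2), of "\<lambda>y. \<theta> y v" "\<lambda>y. \<theta>' y v"] assms(3))

lemma iddbar_cong_open:
  assumes "open S" "x \<in> S" "\<And>y. y \<in> S \<Longrightarrow> f y = g y"
  shows "iddbar f x u v = iddbar g x u v"
proof -
  have "frechet_derivative f (at y) = frechet_derivative g (at y)" if "y \<in> S" for y
    using frechet_derivative_cong_open[OF assms(1) that] assms(3) by blast
  then have "ext_deriv1 (\<lambda>x w. - frechet_derivative f (at x) (imult w)) x u v =
      ext_deriv1 (\<lambda>x w. - frechet_derivative g (at x) (imult w)) x u v"
    by (intro ext_deriv1_cong_open[OF assms(1,2)]) simp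
  then show ?thesis by (simp only: iddbar_def)
qed

lemma iddbar_twice_deriv:
  assumes f: "twice_deriv S f f' f''" and y: "y \<in> S"
  shows "iddbar f y u v = (f'' y (imult u) v - f'' y (imult v) u) / 2"
proof -
  have "ext_deriv1 (\<lambda>x w. - frechet_derivative f (at x) (imult w)) y u v
      = ext_deriv1 (\<lambda>x w. - f' x (imult w)) y u v"
    using twice_derivD(1)[OF f] y
    by (rule ext_deriv1_cong_open) (simp add: frechet_derivative_at[OF twice_derivD(2)[OF f], symmetric])
  also have "\<dots> = - f'' y (imult v) u - (- f'' y (imult u) v)"
    by (rule ext_deriv1_eqI) (auto intro!: derivative_intros twice_derivD(3)[OF f y])
  finally show ?thesis by (simp add: iddbar_def)
qed

lemma twice_deriv_mono:
  "twice_deriv S f f' f'' \<Longrightarrow> open S' \<Longrightarrow> S' \<subseteq> S \<Longrightarrow> twice_deriv S' f f' f''"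
  by (auto simp: twice_deriv_def)

lemma twice_deriv_add:
  assumes "twice_deriv S f f' f''" "twice_deriv S g g' g''"
  shows "twice_deriv S (\<lambda>x. f x + g x) (\<lambda>x v. f' x v + g' x v) (\<lambda>x v w. f'' x v w + g'' x v w)"
  using assms by (auto simp: twice_deriv_def intro!: derivative_intros)

lemma twice_deriv_uminus:
  assumes "twice_deriv S f f' f''"
  shows "twice_deriv S (\<lambda>x. - f x) (\<lambda>x v. - f' x v) (\<lambda>x v w. - f'' x v w)"
  using assms by (auto simp: twice_deriv_def intro!: derivative_intros)

lemma twice_deriv_compose:
  fixes k :: "real \<Rightarrow> real"
  assumes s: "twice_deriv S s s' s''"
    and k: "\<And>t. (k has_real_derivative k1 t) (at t)" "\<And>t. (k1 has_real_derivative k2 t) (at t)"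
  shows "twice_deriv S (\<lambda>x. k (s x)) (\<lambda>x v. k1 (s x) * s' x v)
     (\<lambda>x v w. k2 (s x) * s' x w * s' x v + k1 (s x) * s'' x v w)"
proof (rule twice_derivI[OF twice_derivD(1)[OF s]])
  fix x v assume x: "x \<in> S"
  have D: "((\<lambda>x. k (s x)) has_derivative (\<lambda>v. k1 (s x) * s' x v)) (at x)"
    using has_derivative_compose[OF twice_derivD(2)[OF s x] k(1)[of "s x", unfolded has_field_derivative_def]] .
  have D1: "((\<lambda>x. k1 (s x)) has_derivative (\<lambda>v. k2 (s x) * s' x v)) (at x)"
    using has_derivative_compose[OF twice_derivD(2)[OF s x] k(2)[of "s x", unfolded has_field_derivative_def]] .
  show "((\<lambda>x. k (s x)) has_derivative (\<lambda>v. k1 (s x) * s' x v)) (at x)" by (fact D)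
  show "((\<lambda>x. k1 (s x) * s' x v) has_derivative (\<lambda>w. k2 (s x) * s' x w * s' x v + k1 (s x) * s'' x v w)) (at x)"
    by (rule has_derivative_eq_rhs[OF has_derivative_mult[OF D1 twice_derivD(3)[OF s x]]])
      (simp add: fun_eq_iff)
qed

lemma twice_deriv_component:
  fixes S :: "complex set" and j :: "'n::finite"
  assumes f: "twice_deriv S f f' f''"
  shows "twice_deriv ((\<lambda>x. x $ j) -` S) (\<lambda>x. f (x $ j)) (\<lambda>x v. f' (x $ j) (v $ j))
     (\<lambda>x v w. f'' (x $ j) (v $ j) (w $ j))"
proof (rule twice_derivI)
  have b: "bounded_linear (\<lambda>x::complex^'n. x $ j)" by (rule bounded_linear_vec_nth)
  then have d: "((\<lambda>x::complex^'n. x $ j) has_derivative (\<lambda>x. x $ j)) (at x)" for x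
    by (rule bounded_linear_imp_has_derivative)
  show "open ((\<lambda>x::complex^'n. x $ j) -` S)"
    using twice_derivD(1)[OF f] by (intro open_vimage continuous_intros) auto
  show "((\<lambda>x. f (x $ j)) has_derivative (\<lambda>v. f' (x $ j) (v $ j))) (at x)"
    if "x \<in> (\<lambda>x. x $ j) -` S" for x :: "complex^'n"
    using has_derivative_compose[OF d twice_derivD(2)[OF f]] that by auto
  show "((\<lambda>x. f' (x $ j) (v $ j)) has_derivative (\<lambda>w. f'' (x $ j) (v $ j) (w $ j))) (at x)"
    if "x \<in> (\<lambda>x. x $ j) -` S" for x v :: "complex^'n"
    using has_derivative_compose[OF d twice_derivD(3)[OF f]] that by auto
qed

lemma imult_vec_nth [simp]: "imult x $ j = imult (x $ j)"
  by (simp add: imult_vec_def)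

lemma iddbar_component:
  fixes S :: "complex set" and j :: "'n::finite"
  assumes f: "twice_deriv S f f' f''" and y: "y $ j \<in> S"
  shows "iddbar (\<lambda>x. f (x $ j)) y u v = iddbar f (y $ j) (u $ j) (v $ j)"
  using y by (simp add: iddbar_twice_deriv[OF f] iddbar_twice_deriv[OF twice_deriv_component[OF f, of j]])

text \<open>The standard area form of the complex plane; in a chart of a Riemann surface every
  2-form is a multiple of it.\<close>

definition area :: "complex \<Rightarrow> complex \<Rightarrow> real" where
  "area u v = Re u * Im v - Im u * Re v"

lemma linear_complex_eq:
  assumes "linear (g :: complex \<Rightarrow> real)"
  shows "g w = Re w * g 1 + Im w * g \<i>"
proof -
  have "w = Re w *\<^sub>R 1 + Im w *\<^sub>R \<i>" by (simp add: complex_eq_iff)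
  then have "g w = g (Re w *\<^sub>R 1 + Im w *\<^sub>R \<i>)" by (rule arg_cong)
  then show ?thesis by (simp add: linear_add[OF assms] linear_cmul[OF assms])
qed

text \<open>In the difference of the two second derivatives the mixed terms cancel and the pure ones
  add up to the Laplacian times \<open>area\<close>.\<close>

lemma iddbar_complex:
  assumes f: "twice_deriv S f f' f''" and y: "y \<in> S"
  shows "iddbar f y u v = area u v * iddbar f y 1 \<i>"
proof -
  \<comment> \<open>A derivative is linear in its direction \<open>w\<close>; linearity in
    \<open>v\<close> is inherited from that of f' at nearby points, by uniqueness of the
    derivative.\<close>
  have f'': "f'' y v w = Re v * f'' y 1 w + Im v * f'' y \<i> w" for v w
  proof -
    have "((\<lambda>x. f' x v) has_derivative (\<lambda>w. Re v * f'' y 1 w + Im v * f'' y \<i> w)) (at y)"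
    proof -
      have "f' x v = Re v * f' x 1 + Im v * f' x \<i>" if "x \<in> S" for x
        using linear_complex_eq[OF twice_deriv_linear(1)[OF f that]] .
      then show ?thesis
        using has_derivative_cong_open[OF twice_derivD(1)[OF f] y, of "\<lambda>x. f' x v"]
        by (auto intro!: derivative_intros twice_derivD(3)[OF f y])
    qed
    then show ?thesis using twice_derivD(3)[OF f y] has_derivative_unique by metis
  qed
  have lin: "f'' y v w = Re w * f'' y v 1 + Im w * f'' y v \<i>" for v w
    using linear_complex_eq[OF twice_deriv_linear(2)[OF f y]] .
  show ?thesis
    unfolding iddbar_twice_deriv[OF f y] area_def imult_complex_def
    unfolding f''[of "\<i> * u"] f''[of "\<i> * v"] f''[of "\<i> * 1"] f''[of "\<i> * \<i>"]
    unfolding lin[of _ u] lin[of _ v] by (simp add: algebra_simps)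
qed

text \<open>The differential is twice the real part of the logarithmic derivative of G, which is
  again holomorphic and can be differentiated once more.\<close>

lemma twice_deriv_ln_norm_holomorphic:
  assumes G: "open S" "G holomorphic_on S" "\<And>z. z \<in> S \<Longrightarrow> G z \<noteq> 0"
  shows "twice_deriv S (\<lambda>z. ln ((cmod (G z))\<^sup>2)) (\<lambda>z v. 2 * Re (deriv G z / G z * v))
     (\<lambda>z v w. 2 * Re (deriv (\<lambda>z. deriv G z / G z) z * w * v))"
proof (rule twice_derivI[OF G(1)])
  fix z v assume z: "z \<in> S"
  have D: "(G has_field_derivative deriv G z) (at z)"
    using G z holomorphic_derivI by blast
  have "((\<lambda>z. (Re (G z))\<^sup>2 + (Im (G z))\<^sup>2) has_derivative
     (\<lambda>v. 2 * Re (G z) * Re (deriv G z * v) + 2 * Im (G z) * Im (deriv G z * v))) (at z)"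
    using D unfolding has_field_derivative_def
    by (auto intro!: derivative_eq_intros simp: fun_eq_iff algebra_simps)
  then have "((\<lambda>z. (cmod (G z))\<^sup>2) has_derivative (\<lambda>v. 2 * Re (G z) * Re (deriv G z * v) + 2 * Im (G z) * Im (deriv G z * v))) (at z)"
    by (simp add: cmod_power2)
  then have "((\<lambda>z. ln ((cmod (G z))\<^sup>2)) has_derivative
     (\<lambda>v. (2 * Re (G z) * Re (deriv G z * v) + 2 * Im (G z) * Im (deriv G z * v)) * inverse ((cmod (G z))\<^sup>2))) (at z)"
    using G(3)[OF z] by (intro has_derivative_ln) auto
  moreover have "(2 * Re (G z) * Re (deriv G z * v) + 2 * Im (G z) * Im (deriv G z * v)) * inverse ((cmod (G z))\<^sup>2)
     = 2 * Re (deriv G z / G z * v)" for v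
  proof -
    have "deriv G z / G z * v = (deriv G z * v) / G z" by simp
    then show ?thesis by (simp only: Re_divide cmod_power2) (simp add: field_simps)
  qed
  ultimately show "((\<lambda>z. ln ((cmod (G z))\<^sup>2)) has_derivative (\<lambda>v. 2 * Re (deriv G z / G z * v))) (at z)"
    by (simp only:)
  define k where "k = (\<lambda>z. deriv G z / G z)"
  have "k holomorphic_on S"
    unfolding k_def using G by (intro holomorphic_intros) auto
  then have "(k has_field_derivative deriv k z) (at z)"
    using G z holomorphic_derivI by blast
  then have "((\<lambda>z. 2 * Re (k z * v)) has_derivative (\<lambda>w. 2 * Re (deriv k z * w * v))) (at z)"
    unfolding has_field_derivative_def by (auto intro!: derivative_eq_intros)
  then show "((\<lambda>z. 2 * Re (deriv G z / G z * v)) has_derivative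
      (\<lambda>w. 2 * Re (deriv (\<lambda>z. deriv G z / G z) z * w * v))) (at z)"
    unfolding k_def .
qed

text \<open>The second derivative depends on its two arguments only through their complex product,
  so the two terms of \<open>iddbar\<close> coincide.\<close>

lemma iddbar_ln_norm_holomorphic:
  assumes G: "open S" "G holomorphic_on S" "\<And>z. z \<in> S \<Longrightarrow> G z \<noteq> 0" and z: "z \<in> S"
  shows "iddbar (\<lambda>z. ln ((cmod (G z))\<^sup>2)) z u v = 0"
proof -
  have "k * v * (\<i> * u) = k * u * (\<i> * v)" for k :: complex by (simp only: mult_ac)
  then show ?thesis
    by (simp only: iddbar_twice_deriv[OF twice_deriv_ln_norm_holomorphic[OF G] z] imult_complex_def) simp
qed

lemma iddbar_add:
  assumes "twice_deriv S f f' f''" "twice_deriv S g g' g''" "y \<in> S"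
  shows "iddbar (\<lambda>x. f x + g x) y u v = iddbar f y u v + iddbar g y u v"
  unfolding iddbar_twice_deriv[OF assms(1,3)] iddbar_twice_deriv[OF assms(2,3)]
    iddbar_twice_deriv[OF twice_deriv_add[OF assms(1,2)] assms(3)] by (simp add: field_simps)

lemma iddbar_compose:
  fixes k :: "real \<Rightarrow> real"
  assumes s: "twice_deriv S s s' s''"
    and k: "\<And>t. (k has_real_derivative k1 t) (at t)" "\<And>t. (k1 has_real_derivative k2 t) (at t)"
    and y: "y \<in> S"
  shows "iddbar (\<lambda>x. k (s x)) y u v = k1 (s y) * iddbar s y u v +
     k2 (s y) / 2 * (s' y v * s' y (imult u) - s' y u * s' y (imult v))"
  unfolding iddbar_twice_deriv[OF s y] iddbar_twice_deriv[OF twice_deriv_compose[OF s k] y]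
  by (simp add: field_simps)

section \<open>Curvature of metrics depending on the logarithm of the norm\<close>

lemma imult_axis [simp]:
  "imult (axis j 1 :: complex^'n::finite) = axis j \<i>" "imult (axis j \<i> :: complex^'n::finite) = - axis j 1"
  by (auto simp: vec_eq_iff axis_def imult_complex_def)

lemma twice_deriv_ln_norm:
  "twice_deriv (- {0}) (\<lambda>z. ln ((cmod z)\<^sup>2)) (\<lambda>z v. 2 * Re (1 / z * v))
     (\<lambda>z v w. 2 * Re (deriv (\<lambda>z. 1 / z) z * w * v))"
  using twice_deriv_ln_norm_holomorphic[of "- {0}" "\<lambda>z. z"] by (simp add: open_Compl)

lemma iddbar_uminus:
  assumes "twice_deriv S f f' f''" "y \<in> S"
  shows "iddbar (\<lambda>x. - f x) y u v = - iddbar f y u v"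
  unfolding iddbar_twice_deriv[OF assms] iddbar_twice_deriv[OF twice_deriv_uminus[OF assms(1)] assms(2)]
  by (simp add: field_simps)

text \<open>\<open>l\<close> is the logarithm of the local norm of the bundle and \<open>g\<close> the coefficient of the
  metric of the curve.\<close>

locale calabi_model =
  fixes U :: "complex set" and l :: "complex \<Rightarrow> real" and l' l'' and g :: "complex \<Rightarrow> real" and k' k''
  assumes l: "twice_deriv U l l' l''"
    and lg: "twice_deriv U (\<lambda>z. ln (g z)) k' k''"
    and g_pos: "\<And>z. z \<in> U \<Longrightarrow> g z > 0"
    and ddl: "\<And>z. z \<in> U \<Longrightarrow> iddbar l z 1 \<i> = g z"
    and ddg: "\<And>z. z \<in> U \<Longrightarrow> iddbar (\<lambda>z. ln (g z)) z 1 \<i> = 2 * g z"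
begin

text \<open>The part w \<noteq> 0 of a chart around the zero divisor. On it \<open>s\<close> is the
  logarithm of the fibrewise norm squared and is smooth.\<close>

definition N :: "(complex^2) set" where "N = {x. x $ 1 \<in> U \<and> x $ 2 \<noteq> 0}"
definition s :: "complex^2 \<Rightarrow> real" where "s x = l (x $ 1) + ln ((cmod (x $ 2))\<^sup>2)"
definition s' :: "complex^2 \<Rightarrow> complex^2 \<Rightarrow> real" where
  "s' x v = l' (x $ 1) (v $ 1) + 2 * Re (1 / x $ 2 * v $ 2)"
definition s'' :: "complex^2 \<Rightarrow> complex^2 \<Rightarrow> complex^2 \<Rightarrow> real" where
  "s'' x v w = l'' (x $ 1) (v $ 1) (w $ 1) + 2 * Re (deriv (\<lambda>z. 1 / z) (x $ 2) * w $ 2 * v $ 2)"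

lemma open_N: "open N"
proof -
  have "N = ((\<lambda>x. x $ 1) -` U) \<inter> ((\<lambda>x. x $ 2) -` (- {0}))" by (auto simp: N_def)
  then show ?thesis
    using twice_derivD(1)[OF twice_deriv_component[OF l, of 1]]
      twice_derivD(1)[OF twice_deriv_component[OF twice_deriv_ln_norm, of 2]] by auto
qed

lemma base_deriv:
  "twice_deriv U f f' f'' \<Longrightarrow> twice_deriv N (\<lambda>x. f (x $ 1)) (\<lambda>x v. f' (x $ 1) (v $ 1))
     (\<lambda>x v w. f'' (x $ 1) (v $ 1) (w $ 1))"
  by (rule twice_deriv_mono[OF twice_deriv_component[where j = 1] open_N]) (auto simp: N_def)

lemma fibre_deriv:
  "twice_deriv N (\<lambda>x. ln ((cmod (x $ 2))\<^sup>2)) (\<lambda>x v. 2 * Re (1 / x $ 2 * v $ 2))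
     (\<lambda>x v w. 2 * Re (deriv (\<lambda>z. 1 / z) (x $ 2) * w $ 2 * v $ 2))"
  by (rule twice_deriv_mono[OF twice_deriv_component[where j = 2, OF twice_deriv_ln_norm] open_N])
    (auto simp: N_def)

lemma s_deriv: "twice_deriv N s s' s''"
  unfolding s_def[abs_def] s'_def[abs_def] s''_def[abs_def]
  by (rule twice_deriv_add[OF base_deriv[OF l] fibre_deriv])

lemma iddbar_fibre: "y \<in> N \<Longrightarrow> iddbar (\<lambda>x. ln ((cmod (x $ 2))\<^sup>2)) y u v = 0"
  using iddbar_component[OF twice_deriv_ln_norm, of y 2]
    iddbar_ln_norm_holomorphic[of "- {0}" "\<lambda>z. z" "y $ 2"] by (simp add: N_def open_Compl)

lemma iddbar_s:
  assumes y: "y \<in> N"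
  shows "iddbar s y u v = g (y $ 1) * area (u $ 1) (v $ 1)"
proof -
  have yU: "y $ 1 \<in> U" using y by (simp add: N_def)
  have "iddbar s y u v = iddbar (\<lambda>x. l (x $ 1)) y u v + iddbar (\<lambda>x. ln ((cmod (x $ 2))\<^sup>2)) y u v"
    unfolding s_def[abs_def] by (rule iddbar_add[OF base_deriv[OF l] fibre_deriv y])
  also have "\<dots> = iddbar l (y $ 1) (u $ 1) (v $ 1)"
    using iddbar_component[OF l yU] iddbar_fibre[OF y] by simp
  also have "\<dots> = area (u $ 1) (v $ 1) * g (y $ 1)"
    using iddbar_complex[OF l yU] ddl[OF yU] by metis
  finally show ?thesis by simp
qed

text \<open>The form \<open>B(s) i\<partial>\<partial>\<close>-bar \<open>s + C(s)/2 ds \<and> d\<^sup>c s\<close>, with \<open>d\<^sup>c s = - ds \<circ> imult\<close>.\<close>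

definition form :: "(real \<Rightarrow> real) \<Rightarrow> (real \<Rightarrow> real) \<Rightarrow> (complex^2) form2" where
  "form B C x u v = B (s x) * g (x $ 1) * area (u $ 1) (v $ 1) +
     C (s x) / 2 * (s' x v * s' x (imult u) - s' x u * s' x (imult v))"

lemma iddbar_s_compose:
  assumes "\<And>t. (k has_real_derivative k1 t) (at t)" "\<And>t. (k1 has_real_derivative k2 t) (at t)" "y \<in> N"
  shows "iddbar (\<lambda>x. k (s x)) y u v = form k1 k2 y u v"
  by (simp add: iddbar_compose[OF s_deriv assms] iddbar_s[OF assms(3)] form_def)

lemma linear_s': "x \<in> N \<Longrightarrow> linear (s' x)"
  using twice_deriv_linear(1)[OF s_deriv] .

lemma s'_minus: "x \<in> N \<Longrightarrow> s' x (- v) = - s' x v"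
  using linear_neg[OF linear_s'] .

lemma s'_fibre: "x \<in> N \<Longrightarrow> s' x (axis 2 1) = 2 * Re (1 / x $ 2)"
   "x \<in> N \<Longrightarrow> s' x (axis 2 \<i>) = - 2 * Im (1 / x $ 2)"
  using linear_0[OF twice_deriv_linear(1)[OF l, of "x $ 1"]] by (simp_all add: s'_def axis_def N_def Re_divide Im_divide)

lemma norm_s'_fibre:
  assumes "x \<in> N"
  shows "(s' x (axis 2 1))\<^sup>2 + (s' x (axis 2 \<i>))\<^sup>2 = 4 / (cmod (x $ 2))\<^sup>2"
proof -
  have "(s' x (axis 2 1))\<^sup>2 + (s' x (axis 2 \<i>))\<^sup>2 = 4 * (cmod (1 / x $ 2))\<^sup>2"
    unfolding s'_fibre[OF assms] cmod_power2[of "1 / x $ 2"] by (simp only: power_mult_distrib) simp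
  then show ?thesis by (simp add: norm_divide power_divide)
qed

text \<open>The base area form and the form ds \<and> dc s both square to zero, so only mixed
  products survive. In these the base form absorbs both base directions, and what remains is the
  fibre part computed in \<open>norm_s'_fibre\<close>.\<close>

lemma wedge_form:
  assumes y: "y \<in> N"
  shows "wedge_density (form B C) (form B' C') y =
     (B (s y) * C' (s y) + B' (s y) * C (s y)) * g (y $ 1) * (2 / (cmod (y $ 2))\<^sup>2)"
proof -
  define P Q R S where "P = s' y (axis 1 1)" "Q = s' y (axis 1 \<i>)" "R = s' y (axis 2 1)" "S = s' y (axis 2 \<i>)"
  have "wedge_density (form B C) (form B' C') y =
     (B (s y) * C' (s y) + B' (s y) * C (s y)) * g (y $ 1) * ((R\<^sup>2 + S\<^sup>2) / 2)"
    unfolding wedge_density_def form_def Let_def imult_axis s'_minus[OF y] P_Q_R_S_def[symmetric]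
    by (simp add: area_def axis_def power2_eq_square field_simps)
  then show ?thesis unfolding P_Q_R_S_def norm_s'_fibre[OF y] by simp
qed

text \<open>All forms of this shape are diagonal in the same coframe, dz and the (1,0)-part of ds,
  with eigenvalues proportional to \<open>B\<close> and \<open>C\<close>.\<close>

lemma form_trace_form:
  assumes y: "y \<in> N" and "B (s y) > 0" "C (s y) > 0"
  shows "form_trace (form B C) (form B' C') y = B' (s y) / B (s y) + C' (s y) / C (s y)"
proof -
  have nz: "g (y $ 1) \<noteq> 0" "y $ 2 \<noteq> 0" using y g_pos by (force simp: N_def)+
  have "2 * ((B' * C + B * C') * G * (2 / W)) / ((B * C + B * C) * G * (2 / W)) = B' / B + C' / C"
    if "B > 0" "C > 0" "G \<noteq> 0" "W \<noteq> 0" for B C B' C' G W :: real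
    using that by (simp add: field_simps)
  from this[OF assms(2,3) nz(1)] nz show ?thesis unfolding form_trace_def wedge_form[OF y] by simp
qed

text \<open>Up to a constant, the logarithm of the volume density is L(s) + ln g - ln |w|^2. The
  last term is killed by \<open>iddbar\<close>; ln g contributes twice the base form by
  \<open>ddg\<close>, which is the 2 in L1 + 2.\<close>

lemma ricci_form_form:
  assumes \<omega>: "\<And>x u v. x \<in> N \<Longrightarrow> \<omega> x u v = form B C x u v"
    and pos: "\<And>t. B t > 0" "\<And>t. C t > 0"
    and L: "\<And>t. L t = ln (B t * C t)" "\<And>t. (L has_real_derivative L1 t) (at t)"
      "\<And>t. (L1 has_real_derivative L2 t) (at t)"
    and y: "y \<in> N"
  shows "ricci_form \<omega> y u v = form (\<lambda>t. - (L1 t + 2)) (\<lambda>t. - L2 t) y u v"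
proof -
  have yU: "y $ 1 \<in> U" using y by (simp add: N_def)
  define k where "k t = L t + ln 4" for t
  have dk: "(k has_real_derivative L1 t) (at t)" for t
    unfolding k_def[abs_def] by (auto intro!: derivative_eq_intros L)
  have ln_prod: "ln (4 * P * G / W) = ln P + ln 4 + (ln G + - ln W)"
    if "P > 0" "G > 0" "W > 0" for P G W :: real
    using that by (simp add: ln_mult_pos ln_div)
  have ln_eq: "ln (wedge_density \<omega> \<omega> x) = k (s x) + (ln (g (x $ 1)) + - ln ((cmod (x $ 2))\<^sup>2))"
    if x: "x \<in> N" for x
  proof -
    have p: "g (x $ 1) > 0" "(cmod (x $ 2))\<^sup>2 > 0" "B (s x) * C (s x) > 0"
      using x g_pos pos by (auto simp: N_def)
    have "wedge_density \<omega> \<omega> x = wedge_density (form B C) (form B C) x"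
      using \<omega>[OF x] by (simp add: wedge_density_def)
    also have "\<dots> = 4 * (B (s x) * C (s x)) * g (x $ 1) / (cmod (x $ 2))\<^sup>2"
      by (simp add: wedge_form[OF x])
    finally show ?thesis using ln_prod[OF p(3,1,2)] by (simp only: k_def L(1))
  qed
  have "iddbar (\<lambda>x. ln (wedge_density \<omega> \<omega> x)) y u v =
      iddbar (\<lambda>x. k (s x) + (ln (g (x $ 1)) + - ln ((cmod (x $ 2))\<^sup>2))) y u v"
    by (rule iddbar_cong_open[OF open_N y ln_eq])
  also have "\<dots> = iddbar (\<lambda>x. k (s x)) y u v + iddbar (\<lambda>x. ln (g (x $ 1)) + - ln ((cmod (x $ 2))\<^sup>2)) y u v"
    by (rule iddbar_add[OF twice_deriv_compose[OF s_deriv dk L(3)]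
        twice_deriv_add[OF base_deriv[OF lg] twice_deriv_uminus[OF fibre_deriv]] y])
  also have "iddbar (\<lambda>x. ln (g (x $ 1)) + - ln ((cmod (x $ 2))\<^sup>2)) y u v =
      iddbar (\<lambda>x. ln (g (x $ 1))) y u v + iddbar (\<lambda>x. - ln ((cmod (x $ 2))\<^sup>2)) y u v"
    by (rule iddbar_add[OF base_deriv[OF lg] twice_deriv_uminus[OF fibre_deriv] y])
  also have "iddbar (\<lambda>x. - ln ((cmod (x $ 2))\<^sup>2)) y u v = - iddbar (\<lambda>x. ln ((cmod (x $ 2))\<^sup>2)) y u v"
    by (rule iddbar_uminus[OF fibre_deriv y])
  also have "iddbar (\<lambda>x. ln ((cmod (x $ 2))\<^sup>2)) y u v = 0" by (rule iddbar_fibre[OF y])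
  also have "iddbar (\<lambda>x. ln (g (x $ 1))) y u v = area (u $ 1) (v $ 1) * (2 * g (y $ 1))"
    unfolding iddbar_component[where f = "\<lambda>z. ln (g z)", OF lg yU] ddg[OF yU, symmetric]
    by (rule iddbar_complex[OF lg yU])
  also have "iddbar (\<lambda>x. k (s x)) y u v = form L1 L2 y u v"
    by (rule iddbar_s_compose[OF dk L(3) y])
  finally show ?thesis
    unfolding ricci_form_def by (simp add: form_def algebra_simps)
qed

text \<open>\<open>ds x j\<close> is the Wirtinger derivative of \<open>s\<close> in the \<open>j\<close>-th coordinate.\<close>

definition ds :: "complex^2 \<Rightarrow> 2 \<Rightarrow> complex" where
  "ds x j = Complex (s' x (axis j 1) / 2) (- s' x (axis j \<i>) / 2)"

lemma ds_fibre: "x \<in> N \<Longrightarrow> ds x 2 = 1 / x $ 2"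
  by (simp add: ds_def s'_fibre complex_eq_iff)

lemma metric_matrix_form:
  assumes y: "y \<in> N"
  shows "metric_matrix (form B C) y $ j $ k =
     of_real (C (s y)) * ds y j * cnj (ds y k) + (if j = 1 \<and> k = 1 then of_real (B (s y) * g (y $ 1) / 2) else 0)"
  using exhaust_2[of j] exhaust_2[of k]
  unfolding metric_matrix_def form_def vec_lambda_beta imult_axis s'_minus[OF y] ds_def
  by (auto simp: area_def axis_def complex_eq_iff field_simps)

lemma dbar_s_compose:
  assumes G: "\<And>x. x \<in> N \<Longrightarrow> G x = \<gamma> (s x)" and \<gamma>: "\<And>t. (\<gamma> has_real_derivative \<gamma>1 t) (at t)" and y: "y \<in> N"
  shows "dbar k (\<lambda>x. complex_of_real (G x)) y = of_real (\<gamma>1 (s y)) * cnj (ds y k)"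
proof -
  have "((\<lambda>x. \<gamma> (s x)) has_derivative (\<lambda>v. \<gamma>1 (s y) * s' y v)) (at y)"
    using has_derivative_compose[OF twice_derivD(2)[OF s_deriv y] \<gamma>[of "s y", unfolded has_field_derivative_def]] .
  then have "((\<lambda>x. complex_of_real (\<gamma> (s x))) has_derivative (\<lambda>v. complex_of_real (\<gamma>1 (s y) * s' y v))) (at y)"
    by (rule has_derivative_of_real)
  then have "((\<lambda>x. complex_of_real (G x)) has_derivative (\<lambda>v. complex_of_real (\<gamma>1 (s y) * s' y v))) (at y)"
    using has_derivative_cong_open[OF open_N y, of "\<lambda>x. complex_of_real (G x)" "\<lambda>x. complex_of_real (\<gamma> (s x))"] G
    by simp
  note D = frechet_derivative_at[OF this, symmetric]
  show ?thesis unfolding dbar_def D by (simp add: ds_def complex_eq_iff)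
qed

text \<open>The metric matrix is a rank-one matrix built from \<open>ds\<close> plus an entry at
  position (1,1). A vector with vanishing first component does not meet that entry, so the gradient
  of a function of s is a multiple of the fibre field w d/dw. This candidate is shown to solve the
  linear system that defines the gradient.\<close>

lemma grad10_form:
  assumes \<omega>: "\<And>x u v. x \<in> N \<Longrightarrow> \<omega> x u v = form B C x u v"
    and pos: "\<And>t. B t > 0" "\<And>t. C t > 0"
    and G: "\<And>x. x \<in> N \<Longrightarrow> G x = \<gamma> (s x)" and \<gamma>: "\<And>t. (\<gamma> has_real_derivative \<gamma>1 t) (at t)" and y: "y \<in> N"
  shows "grad10 \<omega> G y $ 2 = y $ 2 * of_real (\<gamma>1 (s y) / C (s y))"
proof -
  define H where "H = transpose (metric_matrix \<omega> y)"
  define c where "c = complex_of_real (C (s y))"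
  define b where "b = complex_of_real (B (s y) * g (y $ 1) / 2)"
  have y2: "y $ 2 \<noteq> 0" and yU: "y $ 1 \<in> U" using y by (auto simp: N_def)
  have c0: "c \<noteq> 0" using pos(2)[of "s y"] by (simp add: c_def)
  have b0: "b \<noteq> 0" using pos(1)[of "s y"] g_pos[OF yU] by (simp add: b_def)
  have mm: "metric_matrix \<omega> y = metric_matrix (form B C) y" using \<omega>[OF y] by (simp add: metric_matrix_def)
  have H: "H $ k $ j = c * ds y j * cnj (ds y k) + (if j = 1 \<and> k = 1 then b else 0)" for j k
    unfolding H_def mm transpose_def by (simp add: metric_matrix_form[OF y] c_def b_def)
  define V :: "complex^2" where "V = vector [0, y $ 2 * of_real (\<gamma>1 (s y) / C (s y))]"
  have HV: "H *v V = (\<chi> k. dbar k (\<lambda>x. complex_of_real (G x)) y)"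
  proof (subst vec_eq_iff, rule allI)
    fix k :: 2
    have "(H *v V) $ k = c * (1 / y $ 2) * cnj (ds y k) * (y $ 2 * of_real (\<gamma>1 (s y) / C (s y)))"
      by (simp add: matrix_vector_mult_def sum_2 V_def H ds_fibre[OF y])
    also have "\<dots> = of_real (\<gamma>1 (s y)) * cnj (ds y k)"
      using y2 c0 by (simp add: c_def)
    finally show "(H *v V) $ k = (\<chi> k. dbar k (\<lambda>x. complex_of_real (G x)) y) $ k"
      by (simp add: dbar_s_compose[OF G \<gamma> y])
  qed
  \<comment> \<open>As \<open>matrix_inv\<close> is a choice, invertibility has to be known before
    it can be cancelled.\<close>
  have "det H = b * c * (1 / y $ 2) * cnj (1 / y $ 2)"
    unfolding det_2 by (simp add: H ds_fibre[OF y] algebra_simps add_divide_distrib)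
  then have "det H \<noteq> 0" using b0 c0 y2 by simp
  then have "invertible H" by (simp add: invertible_det_nz)
  then have "matrix_inv H ** H = mat 1"
    unfolding matrix_inv_def invertible_def by (rule someI2_ex) simp
  then have "matrix_inv H *v (H *v V) = V" by (simp add: matrix_vector_mul_assoc)
  then have "grad10 \<omega> G y = V" unfolding grad10_def HV[symmetric] H_def[symmetric] .
  then show ?thesis by (simp add: V_def)
qed

text \<open>The factor w is holomorphic, so dbar differentiates only \<gamma>1 / C and returns q(s)
  times w cnj(1/w), a factor without zeros on \<open>N\<close>. This is how the extremal equation
  becomes constancy of \<gamma>1 / C.\<close>

lemma dbar_grad10_form:
  assumes \<omega>: "\<And>x u v. x \<in> N \<Longrightarrow> \<omega> x u v = form B C x u v"
    and pos: "\<And>t. B t > 0" "\<And>t. C t > 0"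
    and G: "\<And>x. x \<in> N \<Longrightarrow> G x = \<gamma> (s x)" and \<gamma>: "\<And>t. (\<gamma> has_real_derivative \<gamma>1 t) (at t)"
    and q: "\<And>t. ((\<lambda>t. \<gamma>1 t / C t) has_real_derivative q t) (at t)"
    and y: "y \<in> N" and zero: "dbar 2 (\<lambda>x. grad10 \<omega> G x $ 2) y = 0"
  shows "q (s y) = 0"
proof -
  have y2: "y $ 2 \<noteq> 0" using y by (auto simp: N_def)
  define A where "A t = \<gamma>1 t / C t" for t
  have "((\<lambda>x. A (s x)) has_derivative (\<lambda>v. q (s y) * s' y v)) (at y)"
    using has_derivative_compose[OF twice_derivD(2)[OF s_deriv y] q[of "s y", unfolded has_field_derivative_def]]
    unfolding A_def .
  then have "((\<lambda>x. complex_of_real (A (s x))) has_derivative (\<lambda>v. complex_of_real (q (s y) * s' y v))) (at y)"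
    by (rule has_derivative_of_real)
  moreover have "((\<lambda>x. x $ 2) has_derivative (\<lambda>v. v $ 2)) (at y)"
    by (rule bounded_linear_imp_has_derivative[OF bounded_linear_vec_nth])
  ultimately have D: "((\<lambda>x. x $ 2 * complex_of_real (A (s x))) has_derivative
      (\<lambda>v. y $ 2 * complex_of_real (q (s y) * s' y v) + v $ 2 * complex_of_real (A (s y)))) (at y)"
    using has_derivative_mult by blast
  have "((\<lambda>x. grad10 \<omega> G x $ 2) has_derivative
      (\<lambda>v. y $ 2 * complex_of_real (q (s y) * s' y v) + v $ 2 * complex_of_real (A (s y)))) (at y)"
    using has_derivative_cong_open[OF open_N y, of "\<lambda>x. grad10 \<omega> G x $ 2" "\<lambda>x. x $ 2 * complex_of_real (A (s x))"]
      D grad10_form[OF \<omega> pos G \<gamma>] by (simp add: A_def)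
  note D' = frechet_derivative_at[OF this, symmetric]
  from zero have "y $ 2 * complex_of_real (q (s y)) * (complex_of_real (s' y (axis 2 1)) + \<i> * complex_of_real (s' y (axis 2 \<i>))) = 0"
    unfolding dbar_def D' by (simp add: axis_nth algebra_simps)
  moreover have "complex_of_real (2 * Re p) + \<i> * complex_of_real (- 2 * Im p) = 2 * cnj p" for p
    by (simp add: complex_eq_iff)
  then have "complex_of_real (s' y (axis 2 1)) + \<i> * complex_of_real (s' y (axis 2 \<i>)) = 2 * cnj (1 / y $ 2)"
    unfolding s'_fibre[OF y] .
  ultimately show ?thesis using y2 by simp
qed

end

section \<open>Coordinates on the projective bundle\<close>

lemma chart_open_image:
  assumes "riemann_surface T A" "\<kappa> \<in> A" "openin T W"
  shows "open (snd \<kappa> ` (fst \<kappa> \<inter> W))"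
proof -
  have h: "homeomorphic_map (subtopology T (fst \<kappa>)) (top_of_set (chart_image \<kappa>)) (snd \<kappa>)"
    and o: "open (chart_image \<kappa>)" "openin T (fst \<kappa>)"
    using assms(1,2) by (auto simp: riemann_surface_def)
  have "openin (subtopology T (fst \<kappa>)) (fst \<kappa> \<inter> W)"
    using assms(3) by (auto simp: openin_subtopology)
  then have "openin (top_of_set (chart_image \<kappa>)) (snd \<kappa> ` (fst \<kappa> \<inter> W))"
    using homeomorphic_imp_open_map[OF h] unfolding open_map_def by blast
  then show ?thesis using o(1) openin_open_trans by blast
qed

lemma chart_inv_chart:
  assumes "riemann_surface T A" "\<kappa> \<in> A" "x \<in> fst \<kappa>"
  shows "chart_inv \<kappa> (snd \<kappa> x) = x"
proof -
  have h: "homeomorphic_map (subtopology T (fst \<kappa>)) (top_of_set (chart_image \<kappa>)) (snd \<kappa>)"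
    and o: "openin T (fst \<kappa>)"
    using assms(1,2) by (auto simp: riemann_surface_def)
  have "inj_on (snd \<kappa>) (fst \<kappa>)"
    using homeomorphic_imp_injective_map[OF h] openin_subset[OF o] by (simp add: Int_absorb1)
  then show ?thesis using assms(3) by (simp add: chart_inv_def)
qed

context
  fixes T :: "'a topology" and A :: "('a, complex) chart set" and L :: "('a, 'e) line_bundle"
  assumes L: "holomorphic_line_bundle T A L"
begin

lemma triv_fibre:
  assumes "t \<in> trivs L" "x \<in> fst t"
  obtains e where "e \<in> total L" "bproj L e = x" "snd t e = w"
proof -
  have "bij_betw (snd t) {e \<in> total L. bproj L e = x} UNIV"
    using L assms unfolding holomorphic_line_bundle_def by fastforce
  then have "w \<in> snd t ` {e \<in> total L. bproj L e = x}" by (simp add: bij_betw_def)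
  then show ?thesis using that by blast
qed

lemma triv_open: "t \<in> trivs L \<Longrightarrow> openin T (fst t)"
  using L unfolding holomorphic_line_bundle_def by fastforce

lemma triv_change:
  assumes "t \<in> trivs L" "t' \<in> trivs L"
  shows "\<exists>g. (\<forall>x\<in>fst t \<inter> fst t'. g x \<noteq> 0) \<and>
     (\<forall>\<kappa>\<in>A. (g \<circ> chart_inv \<kappa>) holomorphic_on snd \<kappa> ` (fst \<kappa> \<inter> (fst t \<inter> fst t'))) \<and>
     (\<forall>e\<in>total L. bproj L e \<in> fst t \<inter> fst t' \<longrightarrow> snd t' e = g (bproj L e) * snd t e)"
proof -
  have "\<forall>t\<in>trivs L. \<forall>t'\<in>trivs L. \<exists>g. (\<forall>x\<in>fst t \<inter> fst t'. g x \<noteq> 0) \<and>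
     (\<forall>\<kappa>\<in>A. (g \<circ> chart_inv \<kappa>) holomorphic_on snd \<kappa> ` (fst \<kappa> \<inter> (fst t \<inter> fst t'))) \<and>
     (\<forall>e\<in>total L. bproj L e \<in> fst t \<inter> fst t' \<longrightarrow> snd t' e = g (bproj L e) * snd t e)"
    using L unfolding holomorphic_line_bundle_def case_prod_beta by (elim conjE)
  then show ?thesis using assms by blast
qed

lemma bline_self: "e \<in> total L \<Longrightarrow> (e, c) \<in> bline L e c"
  by (auto simp: bline_def intro!: exI[of _ 1])

lemma bline_coords:
  assumes "t \<in> trivs L" "bproj L e \<in> fst t" "(e', c') \<in> bline L e c"
  obtains \<mu> where "c' = \<mu> * c" "snd t e' = \<mu> * snd t e"
  using assms by (fastforce simp: bline_def)

lemma base_point_bline: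
  assumes "e \<in> total L"
  shows "base_point L (bline L e c) = bproj L e"
  unfolding base_point_def
proof (rule the_equality)
  show "\<forall>(e', c')\<in>bline L e c. bproj L e' = bproj L e" by (auto simp: bline_def)
qed (use bline_self[OF assms] in fastforce)

text \<open>All vectors of a line are scalar multiples of its generator
  (\<open>bline_coords\<close>), so the definite description in \<open>zero_chart\<close> is the
  quotient of the generator's coordinates.\<close>

lemma zero_coord:
  assumes "t \<in> trivs L" "e \<in> total L" "bproj L e \<in> fst t"
  shows "(\<exists>(e', c')\<in>bline L e c. c' \<noteq> 0) \<longleftrightarrow> c \<noteq> 0"
    "c \<noteq> 0 \<Longrightarrow> (THE w. \<forall>(e', c')\<in>bline L e c. snd t e' = w * c') = snd t e / c"
proof -
  show "(\<exists>(e', c')\<in>bline L e c. c' \<noteq> 0) \<longleftrightarrow> c \<noteq> 0"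
    using bexI[of "\<lambda>(e', c'). c' \<noteq> 0", OF _ bline_self[OF assms(2), of c]] by (auto simp: bline_def)
  show "(THE w. \<forall>(e', c')\<in>bline L e c. snd t e' = w * c') = snd t e / c" if "c \<noteq> 0"
  proof (rule the_equality)
    show "\<forall>(e', c')\<in>bline L e c. snd t e' = snd t e / c * c'"
      using that by (auto elim!: bline_coords[OF assms(1,3)])
  qed (use bline_self[OF assms(2), of c] that in force)
qed

lemma infinity_coord:
  assumes "t \<in> trivs L" "e \<in> total L" "bproj L e \<in> fst t"
  shows "(\<exists>(e', c')\<in>bline L e c. snd t e' \<noteq> 0) \<longleftrightarrow> snd t e \<noteq> 0"
    "snd t e \<noteq> 0 \<Longrightarrow> (THE w. \<forall>(e', c')\<in>bline L e c. c' = w * snd t e') = c / snd t e"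
proof -
  show "(\<exists>(e', c')\<in>bline L e c. snd t e' \<noteq> 0) \<longleftrightarrow> snd t e \<noteq> 0"
    using bexI[of "\<lambda>(e', c'). snd t e' \<noteq> 0", OF _ bline_self[OF assms(2), of c]]
    by (auto elim!: bline_coords[OF assms(1,3)])
  show "(THE w. \<forall>(e', c')\<in>bline L e c. c' = w * snd t e') = c / snd t e" if "snd t e \<noteq> 0"
  proof (rule the_equality)
    show "\<forall>(e', c')\<in>bline L e c. c' = c / snd t e * snd t e'"
      using that by (auto elim!: bline_coords[OF assms(1,3)])
  qed (use bline_self[OF assms(2), of c] that in force)
qed

lemma bline_in_proj_bundle:
  assumes "t \<in> trivs L" "e \<in> total L" "bproj L e \<in> fst t" "c \<noteq> 0 \<or> snd t e \<noteq> 0"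
  shows "bline L e c \<in> proj_bundle L"
  using assms by (fastforce simp: proj_bundle_def is_zero_vector_def)

text \<open>There is no restriction in the fibre direction: y is the coordinate of the line through
  (e, 1), where e has fibre coordinate y $ 2.\<close>

lemma chart_image_zero_chart:
  assumes "\<kappa> \<in> A" "t \<in> trivs L"
  shows "chart_image (zero_chart L \<kappa> t) = {y. y $ 1 \<in> snd \<kappa> ` (fst \<kappa> \<inter> fst t)}"
proof (intro equalityI subsetI)
  fix y assume "y \<in> chart_image (zero_chart L \<kappa> t)"
  then show "y \<in> {y. y $ 1 \<in> snd \<kappa> ` (fst \<kappa> \<inter> fst t)}"
    by (auto simp: chart_image_def zero_chart_def)
next
  fix y :: "complex^2" assume "y \<in> {y. y $ 1 \<in> snd \<kappa> ` (fst \<kappa> \<inter> fst t)}"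
  then obtain x where x: "x \<in> fst \<kappa> \<inter> fst t" "y $ 1 = snd \<kappa> x" by auto
  obtain e where e: "e \<in> total L" "bproj L e = x" "snd t e = y $ 2"
    using triv_fibre[OF assms(2)] x by blast
  have "bline L e 1 \<in> fst (zero_chart L \<kappa> t)" "snd (zero_chart L \<kappa> t) (bline L e 1) = y"
    using x e zero_coord[OF assms(2) e(1), of 1] bline_in_proj_bundle[OF assms(2) e(1), of 1]
    by (auto simp: zero_chart_def base_point_bline vec_eq_iff forall_2)
  then show "y \<in> chart_image (zero_chart L \<kappa> t)" unfolding chart_image_def by force
qed

lemma infinity_chart_image:
  assumes "\<kappa> \<in> A" "t \<in> trivs L" "y $ 1 \<in> snd \<kappa> ` (fst \<kappa> \<inter> fst t)"
  shows "y \<in> chart_image (infinity_chart L \<kappa> t)"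
proof -
  obtain x where x: "x \<in> fst \<kappa> \<inter> fst t" "y $ 1 = snd \<kappa> x" using assms(3) by auto
  obtain e where e: "e \<in> total L" "bproj L e = x" "snd t e = 1"
    using triv_fibre[OF assms(2)] x by blast
  have "bline L e (y $ 2) \<in> fst (infinity_chart L \<kappa> t)" "snd (infinity_chart L \<kappa> t) (bline L e (y $ 2)) = y"
    using x e infinity_coord[OF assms(2) e(1), of "y $ 2"] bline_in_proj_bundle[OF assms(2) e(1), of "y $ 2"]
    by (auto simp: infinity_chart_def base_point_bline vec_eq_iff forall_2)
  then show "y \<in> chart_image (infinity_chart L \<kappa> t)" unfolding chart_image_def by force
qed

text \<open>A generator (e, c) has the fibre coordinate \<open>snd t e / c\<close> in one chart and
  the reciprocal in the other.\<close>

lemma zero_infinity_transition: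
  assumes "\<kappa> \<in> A" "t \<in> trivs L" "y $ 1 \<in> snd \<kappa> ` (fst \<kappa> \<inter> fst t)" "y $ 2 \<noteq> 0"
  shows "y \<in> chart_overlap (zero_chart L \<kappa> t) (infinity_chart L \<kappa> t)"
    "transition (zero_chart L \<kappa> t) (infinity_chart L \<kappa> t) y = axis 1 (y $ 1) + axis 2 (1 / y $ 2)"
proof -
  define p where "p = chart_inv (zero_chart L \<kappa> t) y"
  have "y \<in> chart_image (zero_chart L \<kappa> t)" using chart_image_zero_chart[OF assms(1,2)] assms(3) by simp
  then have p: "p \<in> fst (zero_chart L \<kappa> t)" "snd (zero_chart L \<kappa> t) p = y"
    unfolding p_def chart_inv_def chart_image_def by (auto intro: inv_into_into f_inv_into_f)
  then obtain e c where ec: "p = bline L e c" "e \<in> total L"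
    by (auto simp: zero_chart_def proj_bundle_def)
  have b: "bproj L e \<in> fst \<kappa> \<inter> fst t" and c: "c \<noteq> 0"
    using p(1) ec zero_coord(1)[OF assms(2) ec(2)] by (auto simp: zero_chart_def base_point_bline)
  have y: "y $ 1 = snd \<kappa> (bproj L e)" "y $ 2 = snd t e / c"
    using p(2) ec zero_coord(2)[OF assms(2) ec(2) _ c] b by (auto simp: zero_chart_def base_point_bline)
  have ne: "snd t e \<noteq> 0" using y(2) assms(4) by auto
  have inf: "p \<in> fst (infinity_chart L \<kappa> t)"
    using p(1) ec b ne infinity_coord(1)[OF assms(2) ec(2)]
    by (auto simp: zero_chart_def infinity_chart_def base_point_bline)
  then show "y \<in> chart_overlap (zero_chart L \<kappa> t) (infinity_chart L \<kappa> t)"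
    unfolding chart_overlap_def using p by force
  have "snd (infinity_chart L \<kappa> t) p = axis 1 (y $ 1) + axis 2 (1 / y $ 2)"
    using ec b y ne infinity_coord(2)[OF assms(2) ec(2) _ ne]
    by (auto simp: infinity_chart_def base_point_bline vec_eq_iff forall_2 axis_def)
  then show "transition (zero_chart L \<kappa> t) (infinity_chart L \<kappa> t) y = axis 1 (y $ 1) + axis 2 (1 / y $ 2)"
    by (simp add: transition_def p_def)
qed

end

lemma has_derivative_axis_inverse:
  fixes y :: "complex^2"
  assumes "y $ 2 \<noteq> 0"
  shows "((\<lambda>y. axis 1 (y $ 1) + axis 2 (1 / y $ 2)) has_derivative
     (\<lambda>u. axis 1 (u $ 1) + axis 2 (- u $ 2 / (y $ 2)\<^sup>2) :: complex^2)) (at y)"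
proof -
  have ax: "bounded_linear (axis j :: complex \<Rightarrow> complex^2)" for j
    by (intro linear_conv_bounded_linear[THEN iffD1] linearI) (auto simp: vec_eq_iff axis_def)
  have n: "((\<lambda>y::complex^2. y $ j) has_derivative (\<lambda>u. u $ j)) (at y)" for j
    by (rule bounded_linear_imp_has_derivative[OF bounded_linear_vec_nth])
  have i: "((\<lambda>y::complex^2. 1 / y $ 2) has_derivative (\<lambda>u. - u $ 2 / (y $ 2)\<^sup>2)) (at y)"
    by (rule has_derivative_eq_rhs[OF has_derivative_divide[OF has_derivative_const n assms]])
      (simp add: fun_eq_iff power2_eq_square divide_inverse mult_ac)
  show ?thesis
    by (intro has_derivative_add bounded_linear.has_derivative[OF ax] n i)
qed

text \<open>Turns smoothness in the sense of \<open>Cinf_on\<close> into witnesses for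
  \<open>twice_deriv\<close>, by unfolding it to order two.\<close>

lemma twice_deriv_ln_Cinf:
  assumes f: "Cinf_on S f" and S: "open S" and pos: "\<And>z. z \<in> S \<Longrightarrow> f z > 0"
  shows "\<exists>f' f''. twice_deriv S (\<lambda>z. ln (f z)) f' f''"
proof -
  define D where "D x = frechet_derivative f (at x)" for x
  define D2 where "D2 x v = frechet_derivative (\<lambda>x. D x v) (at x)" for x v
  have "Ck_on (Suc (Suc 0)) S f" using f unfolding Cinf_on_def by blast
  then have df: "f differentiable (at x)" and ddf: "(\<lambda>x. D x v) differentiable (at x)" if "x \<in> S" for x v
    using that by (auto simp: D_def)
  have Df: "(f has_derivative D x) (at x)" and DDf: "((\<lambda>x. D x v) has_derivative D2 x v) (at x)"
    if "x \<in> S" for x v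
    using df[OF that] ddf[OF that] frechet_derivative_works unfolding D_def D2_def by blast+
  have "twice_deriv S (\<lambda>z. ln (f z)) (\<lambda>x v. D x v * inverse (f x))
      (\<lambda>x v w. D x v * - (inverse (f x) * D x w * inverse (f x)) + D2 x v w * inverse (f x))"
  proof (rule twice_derivI[OF S])
    fix x v assume x: "x \<in> S"
    have p: "f x > 0" by (rule pos[OF x])
    show "((\<lambda>z. ln (f z)) has_derivative (\<lambda>v. D x v * inverse (f x))) (at x)"
      by (rule has_derivative_ln[OF p Df[OF x]])
    show "((\<lambda>x. D x v * inverse (f x)) has_derivative
        (\<lambda>w. D x v * - (inverse (f x) * D x w * inverse (f x)) + D2 x v w * inverse (f x))) (at x)"
      using p by (intro has_derivative_mult DDf[OF x] Deriv.has_derivative_inverse Df[OF x]) simp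
  qed
  then show ?thesis by blast
qed

lemma chart_inv_image:
  assumes "riemann_surface T A" "\<kappa> \<in> A" "z \<in> snd \<kappa> ` (fst \<kappa> \<inter> W)"
  shows "chart_inv \<kappa> z \<in> fst \<kappa> \<inter> W" "snd \<kappa> (chart_inv \<kappa> z) = z"
  using assms chart_inv_chart by fastforce+

text \<open>The definition of the curvature picks a trivialization at every point, so changing the
  trivialization is unavoidable: it adds the logarithm of the norm of a holomorphic function.\<close>

lemma iddbar_ln_hermitian:
  assumes T: "riemann_surface T A" and L: "holomorphic_line_bundle T A L" and h: "hermitian_metric A L h"
    and \<kappa>: "\<kappa> \<in> A" and t: "t \<in> trivs L" and z: "z \<in> snd \<kappa> ` (fst \<kappa> \<inter> fst t)"
  shows "iddbar (\<lambda>z. ln (h t (chart_inv \<kappa> z))) z u v = - bundle_curvature L h \<kappa> z u v"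
proof -
  define t' where "t' = (SOME t. t \<in> trivs L \<and> chart_inv \<kappa> z \<in> fst t)"
  have "t' \<in> trivs L \<and> chart_inv \<kappa> z \<in> fst t'"
    unfolding t'_def by (rule someI[of _ t]) (use t chart_inv_image(1)[OF T \<kappa> z] in simp)
  then have t': "t' \<in> trivs L" "chart_inv \<kappa> z \<in> fst t'" by auto
  obtain V V' where V: "V = fst t" "V' = fst t'" by simp
  have op: "openin T V" "openin T V'" unfolding V using triv_open[OF L] t t' by blast+
  obtain G where G: "\<And>x. x \<in> V \<inter> V' \<Longrightarrow> G x \<noteq> 0"
     "(G \<circ> chart_inv \<kappa>) holomorphic_on snd \<kappa> ` (fst \<kappa> \<inter> (V \<inter> V'))"
     "\<And>e. e \<in> total L \<Longrightarrow> bproj L e \<in> V \<inter> V' \<Longrightarrow> snd t' e = G (bproj L e) * snd t e"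
    using triv_change[OF L t t'(1)] \<kappa> unfolding V by blast
  have hpos: "h t x > 0" if "t \<in> trivs L" "x \<in> fst t" for t x
    using h that unfolding hermitian_metric_def by blast
  \<comment> \<open>The norm of the vector with coordinate 1 in \<open>t\<close> is computed in both
    trivializations.\<close>
  have h_eq: "h t x = h t' x * (cmod (G x))\<^sup>2" if x: "x \<in> V \<inter> V'" for x
  proof -
    obtain e where e: "e \<in> total L" "bproj L e = x" "snd t e = 1"
      using triv_fibre[OF L t, of x 1] x by (auto simp: V)
    have "h t (bproj L e) * (cmod (snd t e))\<^sup>2 = h t' (bproj L e) * (cmod (snd t' e))\<^sup>2"
      using h t t'(1) e(1) x[folded e(2)] unfolding hermitian_metric_def V by blast
    moreover have "snd t' e = G x" using G(3)[OF e(1)] e x by (simp add: V)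
    ultimately show ?thesis using e by simp
  qed
  define S where "S = snd \<kappa> ` (fst \<kappa> \<inter> (V \<inter> V'))"
  have S: "open S" unfolding S_def by (rule chart_open_image[OF T \<kappa> openin_Int[OF op]])
  have inS: "chart_inv \<kappa> y \<in> V \<inter> V'" if "y \<in> S" for y
    using chart_inv_image(1)[OF T \<kappa>] that unfolding S_def by blast
  have zS: "z \<in> S"
    using chart_inv_image[OF T \<kappa> z] t' unfolding S_def V by force
  have sub: "S \<subseteq> snd \<kappa> ` (fst \<kappa> \<inter> fst t')" unfolding S_def V by auto
  have cinf: "Cinf_on (snd \<kappa> ` (fst \<kappa> \<inter> fst t')) (\<lambda>y. h t' (chart_inv \<kappa> y))"
    using h t'(1) \<kappa> unfolding hermitian_metric_def comp_def by blast
  have "openin T (fst t')" using op by (simp add: V)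
  then obtain f' f'' where f: "twice_deriv (snd \<kappa> ` (fst \<kappa> \<inter> fst t')) (\<lambda>y. ln (h t' (chart_inv \<kappa> y))) f' f''"
    using twice_deriv_ln_Cinf[OF cinf chart_open_image[OF T \<kappa>]] hpos[OF t'(1)] chart_inv_image(1)[OF T \<kappa>]
    by blast
  note f = twice_deriv_mono[OF f S sub]
  have G0: "(G \<circ> chart_inv \<kappa>) y \<noteq> 0" if "y \<in> S" for y using G(1) inS[OF that] by simp
  note hol = S G(2)[folded S_def] G0
  have "iddbar (\<lambda>z. ln (h t (chart_inv \<kappa> z))) z u v =
      iddbar (\<lambda>z. ln (h t' (chart_inv \<kappa> z)) + ln ((cmod ((G \<circ> chart_inv \<kappa>) z))\<^sup>2)) z u v"
  proof (rule iddbar_cong_open[OF S zS])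
    fix y assume y: "y \<in> S"
    have "h t' (chart_inv \<kappa> y) > 0" using hpos[OF t'(1)] inS[OF y] by (simp add: V)
    then show "ln (h t (chart_inv \<kappa> y)) = ln (h t' (chart_inv \<kappa> y)) + ln ((cmod ((G \<circ> chart_inv \<kappa>) y))\<^sup>2)"
      unfolding h_eq[OF inS[OF y]] using G0[OF y] by (simp add: ln_mult_pos)
  qed
  also have "\<dots> = iddbar (\<lambda>z. ln (h t' (chart_inv \<kappa> z))) z u v +
      iddbar (\<lambda>z. ln ((cmod ((G \<circ> chart_inv \<kappa>) z))\<^sup>2)) z u v"
    by (rule iddbar_add[OF f twice_deriv_ln_norm_holomorphic[OF hol] zS])
  also have "iddbar (\<lambda>z. ln ((cmod ((G \<circ> chart_inv \<kappa>) z))\<^sup>2)) z u v = 0"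
    by (rule iddbar_ln_norm_holomorphic[OF hol zS])
  finally show ?thesis by (simp add: bundle_curvature_def t'_def[symmetric])
qed

section \<open>Boundary behaviour and the coupled equations\<close>

text \<open>Asking for some derivative function instead of iterating
  \<open>frechet_derivative\<close> makes the closure properties direct inductions and fits
  \<open>deriv\<close>. Order 0 is empty, since continuity already follows from order 1.\<close>

primrec ndiff :: "nat \<Rightarrow> (real \<Rightarrow> real) \<Rightarrow> bool" where
  "ndiff 0 f \<longleftrightarrow> True"
| "ndiff (Suc k) f \<longleftrightarrow> (\<exists>f'. (\<forall>x. (f has_real_derivative f' x) (at x)) \<and> ndiff k f')"

definition smooth :: "(real \<Rightarrow> real) \<Rightarrow> bool" where
  "smooth f \<longleftrightarrow> (\<forall>k. ndiff k f)"

lemma ndiff_Suc: "ndiff (Suc k) f \<Longrightarrow> ndiff k f"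
  by (induction k arbitrary: f) auto

lemma ndiff_const: "ndiff k (\<lambda>_. c)"
proof (induction k arbitrary: c)
  case (Suc k)
  then show ?case by (auto intro!: exI[of _ "\<lambda>_. 0"])
qed simp

lemma ndiff_add: "ndiff k f \<Longrightarrow> ndiff k g \<Longrightarrow> ndiff k (\<lambda>x. f x + g x)"
proof (induction k arbitrary: f g)
  case (Suc k)
  then obtain f' g' where "\<And>x. (f has_real_derivative f' x) (at x)" "ndiff k f'"
    "\<And>x. (g has_real_derivative g' x) (at x)" "ndiff k g'" by auto
  then show ?case using Suc.IH[of f' g'] by (auto intro!: exI[of _ "\<lambda>x. f' x + g' x"] DERIV_add)
qed simp

lemma ndiff_mult: "ndiff k f \<Longrightarrow> ndiff k g \<Longrightarrow> ndiff k (\<lambda>x. f x * g x)"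
proof (induction k arbitrary: f g)
  case (Suc k)
  then obtain f' g' where fg: "\<And>x. (f has_real_derivative f' x) (at x)" "ndiff k f'"
    "\<And>x. (g has_real_derivative g' x) (at x)" "ndiff k g'" by auto
  have "ndiff k (\<lambda>x. f' x * g x + g' x * f x)"
    using Suc ndiff_Suc fg by (intro ndiff_add Suc.IH) blast+
  then show ?case using fg by (auto intro!: exI[of _ "\<lambda>x. f' x * g x + g' x * f x"] DERIV_mult)
qed simp

lemma ndiff_inverse: "ndiff k f \<Longrightarrow> (\<And>x. f x \<noteq> 0) \<Longrightarrow> ndiff k (\<lambda>x. inverse (f x))"
proof (induction k arbitrary: f)
  case (Suc k)
  then obtain f' where f: "\<And>x. (f has_real_derivative f' x) (at x)" "ndiff k f'" by auto
  have i: "ndiff k (\<lambda>x. inverse (f x))" using Suc ndiff_Suc by blast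
  have "ndiff k (\<lambda>x. (- 1) * (inverse (f x) * f' x * inverse (f x)))"
    by (intro ndiff_mult ndiff_const i f)
  moreover have "((\<lambda>x. inverse (f x)) has_real_derivative (- 1) * (inverse (f x) * f' x * inverse (f x))) (at x)" for x
    using DERIV_inverse'[OF f(1) Suc.prems(2)] by simp
  ultimately show ?case by fastforce
qed simp

lemma smooth_const: "smooth (\<lambda>_. c)"
  and smooth_add: "smooth f \<Longrightarrow> smooth g \<Longrightarrow> smooth (\<lambda>x. f x + g x)"
  and smooth_mult: "smooth f \<Longrightarrow> smooth g \<Longrightarrow> smooth (\<lambda>x. f x * g x)"
  and smooth_inverse: "smooth f \<Longrightarrow> (\<And>x. f x \<noteq> 0) \<Longrightarrow> smooth (\<lambda>x. inverse (f x))"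
  by (auto simp: smooth_def intro: ndiff_const ndiff_add ndiff_mult ndiff_inverse)

lemma smooth_minus: "smooth f \<Longrightarrow> smooth (\<lambda>x. - f x)"
  using smooth_mult[OF smooth_const[of "- 1"]] by simp

lemma smooth_diff: "smooth f \<Longrightarrow> smooth g \<Longrightarrow> smooth (\<lambda>x. f x - g x)"
  using smooth_add[OF _ smooth_minus] by simp

lemma smooth_divide: "smooth f \<Longrightarrow> smooth g \<Longrightarrow> (\<And>x. g x \<noteq> 0) \<Longrightarrow> smooth (\<lambda>x. f x / g x)"
  using smooth_mult[OF _ smooth_inverse] by (simp add: divide_inverse)

lemma smooth_DERIV:
  assumes "smooth f"
  shows "(f has_real_derivative deriv f x) (at x)"
proof -
  have "ndiff (Suc 0) f" using assms unfolding smooth_def by blast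
  then obtain f' where "(f has_real_derivative f' x) (at x)" by auto
  then show ?thesis using DERIV_imp_deriv by metis
qed

lemma smooth_deriv:
  assumes "smooth f"
  shows "smooth (deriv f)"
  unfolding smooth_def
proof
  fix k
  have "ndiff (Suc k) f" using assms unfolding smooth_def by blast
  then obtain f' where "\<And>x. (f has_real_derivative f' x) (at x)" "ndiff k f'" by auto
  moreover from this have "deriv f = f'" using DERIV_imp_deriv by blast
  ultimately show "ndiff k (deriv f)" by simp
qed

lemma smooth_ln:
  assumes "smooth f" "\<And>x. f x > 0"
  shows "smooth (\<lambda>x. ln (f x))"
  unfolding smooth_def
proof
  fix k show "ndiff k (\<lambda>x. ln (f x))"
  proof (cases k)
    case (Suc j)
    have "smooth (\<lambda>x. inverse (f x) * deriv f x)"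
      using assms smooth_deriv by (intro smooth_mult smooth_inverse) (auto simp: less_imp_neq[symmetric])
    moreover have "((\<lambda>x. ln (f x)) has_real_derivative inverse (f x) * deriv f x) (at x)" for x
      using assms(2)[of x] by (auto intro!: derivative_eq_intros smooth_DERIV assms(1) simp: divide_inverse)
    ultimately show ?thesis unfolding Suc ndiff.simps smooth_def by (intro exI conjI allI) auto
  qed simp
qed

lemma Ck_on_imp_ndiff: "Ck_on k UNIV f \<Longrightarrow> ndiff k f"
proof (induction k arbitrary: f)
  case (Suc k)
  define f' where "f' x = frechet_derivative f (at x) 1" for x
  have "(f has_real_derivative f' x) (at x)" for x
  proof -
    have D: "(f has_derivative frechet_derivative f (at x)) (at x)"
      using Suc.prems frechet_derivative_works by auto
    then have "frechet_derivative f (at x) v = f' x * v" for v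
      using linear_cmul[OF has_derivative_linear[OF D], of v 1] by (simp add: f'_def)
    then have "frechet_derivative f (at x) = (*) (f' x)" by auto
    then show ?thesis using D by (simp add: has_field_derivative_def)
  qed
  moreover have "ndiff k f'" using Suc by (simp add: f'_def)
  ultimately show ?case by auto
qed simp

lemma Cinf_on_imp_smooth: "Cinf_on UNIV f \<Longrightarrow> smooth f"
  by (simp add: Cinf_on_def smooth_def Ck_on_imp_ndiff)

section \<open>Profiles read in the fibre coordinates at the two divisors\<close>

text \<open>With the fibre radius w = exp((t - c)/2) one has \<phi> = w^2 \<gamma>(w) / 2 and
  \<phi>'/\<phi> = 1 + w \<gamma>'(w) / (2 \<gamma>(w)). The correction vanishes as w tends to 0,
  because \<gamma>' is continuous at 0 and \<gamma>(0) > 0.\<close>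

lemma exp_profile_at_bot:
  fixes \<phi> \<phi>' \<gamma> \<gamma>' :: "real \<Rightarrow> real"
  assumes \<gamma>: "\<And>w. (\<gamma> has_real_derivative \<gamma>' w) (at w)" "isCont \<gamma>' 0" "\<And>w. \<gamma> w > 0"
    and \<phi>: "\<And>t. \<phi> t = exp (t - c) / 2 * \<gamma> (exp ((t - c) / 2))"
    and d\<phi>: "\<And>t. (\<phi> has_real_derivative \<phi>' t) (at t)"
  shows "(\<phi> \<longlongrightarrow> 0) at_bot" "((\<lambda>t. \<phi>' t / \<phi> t) \<longlongrightarrow> 1) at_bot"
proof -
  have e: "((\<lambda>t. exp (t - c)) \<longlongrightarrow> 0) at_bot"
    and w: "((\<lambda>t. exp ((t - c) / 2)) \<longlongrightarrow> 0) at_bot" by real_asymp+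
  have g: "((\<lambda>t. \<gamma> (exp ((t - c) / 2))) \<longlongrightarrow> \<gamma> 0) at_bot"
    using isCont_tendsto_compose[OF DERIV_isCont[OF \<gamma>(1)] w] .
  have g': "((\<lambda>t. \<gamma>' (exp ((t - c) / 2))) \<longlongrightarrow> \<gamma>' 0) at_bot"
    using isCont_tendsto_compose[OF \<gamma>(2) w] .
  have "((\<lambda>t. exp (t - c) / 2 * \<gamma> (exp ((t - c) / 2))) \<longlongrightarrow> 0 / 2 * \<gamma> 0) at_bot"
    by (intro tendsto_intros e g) auto
  then show "(\<phi> \<longlongrightarrow> 0) at_bot" unfolding \<phi>[abs_def] by simp
  have ratio: "\<phi>' t / \<phi> t = 1 + \<gamma>' (exp ((t - c) / 2)) * exp ((t - c) / 2) / (2 * \<gamma> (exp ((t - c) / 2)))" for t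
  proof -
    define E where "E = exp ((t - c) / 2)"
    have "(\<phi> has_real_derivative exp (t - c) / 2 * \<gamma> E + exp (t - c) / 2 * (\<gamma>' E * (E / 2))) (at t)"
      unfolding \<phi>[abs_def] E_def
      by (auto intro!: derivative_eq_intros DERIV_chain2[OF \<gamma>(1)])
    then have d: "\<phi>' t = exp (t - c) / 2 * \<gamma> E + exp (t - c) / 2 * (\<gamma>' E * (E / 2))"
      using d\<phi> DERIV_unique by blast
    have "\<gamma> E > 0" by (rule \<gamma>(3))
    then show ?thesis unfolding d \<phi> E_def[symmetric] by (simp add: field_simps)
  qed
  have "((\<lambda>t. 1 + \<gamma>' (exp ((t - c) / 2)) * exp ((t - c) / 2) / (2 * \<gamma> (exp ((t - c) / 2)))) \<longlongrightarrow>
      1 + \<gamma>' 0 * 0 / (2 * \<gamma> 0)) at_bot"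
    using \<gamma>(3)[of 0] by (intro tendsto_intros g g' w) auto
  then show "((\<lambda>t. \<phi>' t / \<phi> t) \<longlongrightarrow> 1) at_bot" unfolding ratio by simp
qed

lemma axis_components [simp]:
  "(axis 1 a :: complex^2) $ 2 = 0" "(axis 2 a :: complex^2) $ 1 = 0"
  by (simp_all add: axis_def)

text \<open>Under the ansatz the vertical density depends on |w| only, so its restriction to the
  real line through the divisor point w = 0 carries all of it.\<close>

lemma Cinf_on_real_line:
  fixes F :: "complex^2 \<Rightarrow> real"
  assumes F: "Cinf_on S F" and S: "\<And>w. axis 1 z + axis 2 w \<in> S"
  obtains D where "\<And>w. ((\<lambda>w. F (axis 1 z + axis 2 (complex_of_real w))) has_real_derivative D w) (at w)"
    "isCont D 0"
proof
  define c where "c w = (axis 1 z + axis 2 (complex_of_real w) :: complex^2)" for w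
  define D where "D w = frechet_derivative F (at (c w)) (axis 2 1)" for w
  have c: "(c has_derivative (\<lambda>h. h *\<^sub>R axis 2 1)) (at w)" for w
  proof -
    have "c = (\<lambda>w. axis 1 z + w *\<^sub>R axis 2 1)" by (simp add: fun_eq_iff c_def vec_eq_iff axis_def of_real_def)
    then show ?thesis by (auto intro!: derivative_eq_intros)
  qed
  have C1: "Ck_on (Suc 0) S F" using F unfolding Cinf_on_def by blast
  have cS: "c w \<in> S" for w using S by (simp add: c_def)
  show "((\<lambda>w. F (axis 1 z + axis 2 (complex_of_real w))) has_real_derivative D w) (at w)" for w
  proof -
    have dF: "(F has_derivative frechet_derivative F (at (c w))) (at (c w))"
      using C1 cS frechet_derivative_works by auto
    have "((\<lambda>w. F (c w)) has_derivative (\<lambda>h. frechet_derivative F (at (c w)) (h *\<^sub>R axis 2 1))) (at w)"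
      by (rule has_derivative_compose[OF c dF])
    moreover have "frechet_derivative F (at (c w)) (h *\<^sub>R axis 2 1) = D w * h" for h
      using linear_cmul[OF has_derivative_linear[OF dF]] by (simp add: D_def)
    ultimately have "((\<lambda>w. F (c w)) has_derivative (*) (D w)) (at w)" by simp
    then show ?thesis by (simp add: has_field_derivative_def c_def)
  qed
  have "continuous_on S (\<lambda>x. frechet_derivative F (at x) (axis 2 1))" using C1 by simp
  moreover have "continuous_on UNIV c"
    using has_derivative_continuous[OF c] by (simp add: continuous_at_imp_continuous_on)
  ultimately have "continuous_on UNIV (\<lambda>w. frechet_derivative F (at (c w)) (axis 2 1))"
    by (rule continuous_on_compose2) (use cS in blast)
  then have "continuous_on UNIV D" by (simp only: D_def[abs_def])
  then show "isCont D 0" by (simp add: continuous_on_eq_continuous_at)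
qed

lemma ruled_atlas_charts:
  assumes "\<kappa> \<in> A" "t \<in> trivs L"
  shows "zero_chart L \<kappa> t \<in> ruled_atlas A L" "infinity_chart L \<kappa> t \<in> ruled_atlas A L"
  unfolding ruled_atlas_def using assms by blast+

text \<open>The vertical part of the metric, read in the two fibre coordinates \<open>w\<close> and \<open>1/w\<close>, has to
  extend smoothly and positively across \<open>w = 0\<close> and \<open>1/w = 0\<close>.\<close>

lemma fibre_profile_boundary:
  assumes T: "riemann_surface T A" and L: "holomorphic_line_bundle T A L"
    and \<kappa>: "\<kappa> \<in> A" and t: "t \<in> trivs L" and z: "z \<in> snd \<kappa> ` (fst \<kappa> \<inter> fst t)"
    and \<omega>: "kaehler_form (ruled_atlas A L) \<omega>"
    and \<phi>: "\<And>y. y $ 1 = z \<Longrightarrow> y $ 2 \<noteq> 0 \<Longrightarrow>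
       \<omega> (zero_chart L \<kappa> t) y (axis 2 1) (axis 2 \<i>) = 2 * \<phi> (c + ln ((cmod (y $ 2))\<^sup>2)) / (cmod (y $ 2))\<^sup>2"
    and d\<phi>: "\<And>t. (\<phi> has_real_derivative \<phi>' t) (at t)"
  shows "\<And>t. \<phi> t > 0" "(\<phi> \<longlongrightarrow> 0) at_bot" "(\<phi> \<longlongrightarrow> 0) at_top"
    "((\<lambda>t. \<phi>' t / \<phi> t) \<longlongrightarrow> 1) at_bot" "((\<lambda>t. \<phi>' t / \<phi> t) \<longlongrightarrow> - 1) at_top"
proof -
  define Z I where ZI: "Z = zero_chart L \<kappa> t" "I = infinity_chart L \<kappa> t"
  have ZA: "Z \<in> ruled_atlas A L" and IA: "I \<in> ruled_atlas A L"
    using ruled_atlas_charts[OF \<kappa> t] ZI by auto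
  define p where "p w = (axis 1 z + axis 2 w :: complex^2)" for w
  have pZ: "p w \<in> chart_image Z" for w
    using chart_image_zero_chart[OF L \<kappa> t] z by (simp add: ZI p_def)
  have pI: "p w \<in> chart_image I" for w
    using infinity_chart_image[OF L \<kappa> t] z by (simp add: ZI p_def)
  have two: "smooth_two_form (ruled_atlas A L) \<omega>"
    using \<omega> by (simp add: kaehler_form_def closed_two_form_def)
  have pos: "\<omega> K y (axis 2 1) (axis 2 \<i>) > 0" if "K \<in> ruled_atlas A L" "y \<in> chart_image K" for K y
  proof -
    have "\<omega> K y u (imult u) > 0" if "u \<noteq> 0" for u
      using \<omega> \<open>K \<in> ruled_atlas A L\<close> \<open>y \<in> chart_image K\<close> that unfolding kaehler_form_def by blast
    from this[of "axis 2 1"] show ?thesis by (simp add: axis_eq_0_iff)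
  qed
  define \<gamma> where "\<gamma> w = \<omega> Z (p (of_real w)) (axis 2 1) (axis 2 \<i>)" for w
  define \<delta> where "\<delta> w = \<omega> I (p (of_real w)) (axis 2 1) (axis 2 \<i>)" for w
  have smooth: "Cinf_on (chart_image Z) (\<lambda>y. \<omega> Z y (axis 2 1) (axis 2 \<i>))"
     "Cinf_on (chart_image I) (\<lambda>y. \<omega> I y (axis 2 1) (axis 2 \<i>))"
    using two ZA IA unfolding smooth_two_form_def by blast+
  obtain \<gamma>' where \<gamma>: "\<And>w. (\<gamma> has_real_derivative \<gamma>' w) (at w)" "isCont \<gamma>' 0"
    using Cinf_on_real_line[OF smooth(1) pZ[unfolded p_def]] unfolding \<gamma>_def p_def by blast
  obtain \<delta>' where \<delta>: "\<And>w. (\<delta> has_real_derivative \<delta>' w) (at w)" "isCont \<delta>' 0"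
    using Cinf_on_real_line[OF smooth(2) pI[unfolded p_def]] unfolding \<delta>_def p_def by blast
  have \<gamma>pos: "\<gamma> w > 0" and \<delta>pos: "\<delta> w > 0" for w
    unfolding \<gamma>_def \<delta>_def using pos ZA IA pZ pI by blast+
  have \<gamma>\<phi>: "\<gamma> w = 2 * \<phi> (c + ln (w\<^sup>2)) / w\<^sup>2" if "w > 0" for w
    using \<phi>[of "p (of_real w)"] that by (simp add: \<gamma>_def p_def ZI)
  have bot: "\<phi> t = exp (t - c) / 2 * \<gamma> (exp ((t - c) / 2))" for t
  proof -
    have "(exp ((t - c) / 2))\<^sup>2 = exp (t - c)" by (simp add: power2_eq_square flip: exp_add)
    then show ?thesis by (simp add: \<gamma>\<phi>)
  qed
  show "\<phi> t > 0" for t unfolding bot using \<gamma>pos by simp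
  show "(\<phi> \<longlongrightarrow> 0) at_bot" "((\<lambda>t. \<phi>' t / \<phi> t) \<longlongrightarrow> 1) at_bot"
    using exp_profile_at_bot[OF \<gamma> \<gamma>pos bot d\<phi>] by auto
  \<comment> \<open>The inversion has fibre derivative -1/w^2, which enters once for each argument
    of the 2-form.\<close>
  have \<gamma>\<delta>: "\<gamma> w = \<delta> (1 / w) / w ^ 4" if w: "w > 0" for w
  proof -
    define y where "y = p (of_real w)"
    have y: "y $ 1 = z" "y $ 2 = of_real w" by (simp_all add: y_def p_def)
    have yU: "y $ 1 \<in> snd \<kappa> ` (fst \<kappa> \<inter> fst t)" "y $ 2 \<noteq> 0" using z w y by auto
    note ov = zero_infinity_transition[OF L \<kappa> t yU, folded ZI]
    define D where "D = frechet_derivative (transition Z I) (at y)"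
    define O' where "O' = {y::complex^2. y $ 1 \<in> snd \<kappa> ` (fst \<kappa> \<inter> fst t) \<and> y $ 2 \<noteq> 0}"
    have "O' = ((\<lambda>y. y $ 1) -` (snd \<kappa> ` (fst \<kappa> \<inter> fst t))) \<inter> ((\<lambda>y. y $ 2) -` (- {0}))"
      by (auto simp: O'_def)
    moreover have "open (snd \<kappa> ` (fst \<kappa> \<inter> fst t))"
      by (rule chart_open_image[OF T \<kappa> triv_open[OF L t]])
    ultimately have "open O'"
      by (auto intro!: open_Int open_vimage continuous_intros simp: open_Compl)
    moreover have "y \<in> O'" using yU by (simp add: O'_def)
    ultimately have "(transition Z I has_derivative (\<lambda>u. axis 1 (u $ 1) + axis 2 (- u $ 2 / (y $ 2)\<^sup>2))) (at y)"
      using has_derivative_cong_open[of O' y "transition Z I" "\<lambda>y. axis 1 (y $ 1) + axis 2 (1 / y $ 2)"]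
        has_derivative_axis_inverse[OF yU(2)] zero_infinity_transition(2)[OF L \<kappa> t, folded ZI]
      by (simp add: O'_def)
    then have D: "D u = axis 1 (u $ 1) + axis 2 (- u $ 2 / (y $ 2)\<^sup>2)" for u
      unfolding D_def by (simp flip: frechet_derivative_at)
    have D2: "D (axis 2 v) = (- 1 / w\<^sup>2) *\<^sub>R axis 2 v" for v
      unfolding D y by (simp add: vec_eq_iff axis_def scaleR_complex.ctr complex_eq_iff)
    have "\<omega> Z y u v = \<omega> I (transition Z I y) (D u) (D v)" for u v
      using two ZA IA ov(1) unfolding smooth_two_form_def Let_def D_def by blast
    then have "\<gamma> w = \<omega> I (transition Z I y) (D (axis 2 1)) (D (axis 2 \<i>))"
      by (simp add: \<gamma>_def y_def)
    also have "transition Z I y = p (of_real (1 / w))" unfolding ov(2) y by (simp add: p_def)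
    also have "\<omega> I (p (of_real (1 / w))) (D (axis 2 1)) (D (axis 2 \<i>)) = (- 1 / w\<^sup>2) * ((- 1 / w\<^sup>2) * \<delta> (1 / w))"
    proof -
      have b: "bilinear (\<omega> I (p (of_real (1 / w))))" using two IA pI unfolding smooth_two_form_def by blast
      show ?thesis unfolding D2 bilinear_lmul[OF b] bilinear_rmul[OF b] \<delta>_def by simp
    qed
    finally show ?thesis by (simp add: power2_eq_square power4_eq_xxxx)
  qed
  \<comment> \<open>Reflecting t exchanges the divisors and replaces c by -c, so the behaviour at
    infinity is again an instance of \<open>exp_profile_at_bot\<close>.\<close>
  have top: "\<phi> (- t) = exp (t - (- c)) / 2 * \<delta> (exp ((t - (- c)) / 2))" for t
  proof -
    define E where "E = exp ((- t - c) / 2)"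
    have E: "E > 0" "E\<^sup>2 = exp (- t - c)" by (simp_all add: E_def power2_eq_square flip: exp_add)
    have inv: "1 / exp x = exp (- x)" for x :: real by (simp add: exp_minus divide_inverse)
    have "1 / E = exp ((t - (- c)) / 2)"
      unfolding E_def inv by (simp add: field_simps)
    moreover have "(1 / E)\<^sup>2 = exp (t - (- c))"
      unfolding power_divide E(2) power_one inv by simp
    moreover have "\<phi> (- t) = (1 / E)\<^sup>2 / 2 * \<delta> (1 / E)"
      unfolding bot[of "- t"] E_def[symmetric] E(2)[symmetric] \<gamma>\<delta>[OF E(1)]
      using E(1) by (simp add: power2_eq_square power4_eq_xxxx)
    ultimately show ?thesis by simp
  qed
  have "((\<lambda>t. \<phi> (- t)) has_real_derivative - \<phi>' (- t)) (at t)" for t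
    using d\<phi>[of "- t"] DERIV_mirror by blast
  note top' = exp_profile_at_bot[OF \<delta> \<delta>pos top this]
  show "(\<phi> \<longlongrightarrow> 0) at_top" using top'(1) by (simp add: filterlim_at_top_mirror)
  have "((\<lambda>t. - (- \<phi>' (- t) / \<phi> (- t))) \<longlongrightarrow> - 1) at_bot" by (intro tendsto_minus top'(2))
  then show "((\<lambda>t. \<phi>' t / \<phi> t) \<longlongrightarrow> - 1) at_top" by (simp add: filterlim_at_top_mirror)
qed

section \<open>Reduction of the coupled equations to ordinary differential equations\<close>

context calabi_model
begin

lemma form_add: "form B C x u v + form B' C' x u v = form (\<lambda>t. B t + B' t) (\<lambda>t. C t + C' t) x u v"
  by (simp add: form_def field_simps)

lemma form_trace_cong:
  assumes "\<And>u v. \<omega> x u v = \<omega>' x u v" "\<And>u v. \<alpha> x u v = \<alpha>' x u v"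
  shows "form_trace \<omega> \<alpha> x = form_trace \<omega>' \<alpha>' x"
  using assms by (simp add: form_trace_def wedge_density_def)

text \<open>Both equations compare coefficient functions evaluated at s(x), and \<open>surj\<close>
  turns pointwise identities on \<open>N\<close> into identities for all real t. Equal Ricci forms
  make the logarithms of the two volume profiles differ by a constant.\<close>

lemma coupled_extremal_ode:
  fixes u v :: "real \<Rightarrow> real"
  assumes sm: "smooth u" "smooth v"
    and pos: "\<And>t. 1 + u t > 0" "\<And>t. deriv u t > 0" "\<And>t. 1 + v t > 0" "\<And>t. deriv v t > 0"
    and \<omega>: "\<And>x \<xi> \<eta>. x \<in> N \<Longrightarrow> \<omega> x \<xi> \<eta> = form (\<lambda>t. 1 + u t) (deriv u) x \<xi> \<eta>"
    and \<omega>': "\<And>x \<xi> \<eta>. x \<in> N \<Longrightarrow> \<omega>' x \<xi> \<eta> = form (\<lambda>t. 1 + v t) (deriv v) x \<xi> \<eta>"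
    and ric: "\<And>x \<xi> \<eta>. x \<in> N \<Longrightarrow> ricci_form \<omega> x \<xi> \<eta> = ricci_form \<omega>' x \<xi> \<eta>"
    and ext: "\<And>x. x \<in> N \<Longrightarrow> dbar 2 (\<lambda>x. grad10 \<omega> (\<lambda>x. scalar_curvature \<omega> x
                   - form_trace \<omega> (\<lambda>x \<xi> \<eta>. \<omega> x \<xi> \<eta> + \<omega>' x \<xi> \<eta>) x) x $ 2) x = 0"
    and surj: "\<And>t. \<exists>x\<in>N. s x = t"
  obtains L1 L2 c \<alpha> \<beta> where
    "\<And>t. L1 t = deriv u t / (1 + u t) + deriv (deriv u) t / deriv u t"
    "\<And>t. (L1 has_real_derivative L2 t) (at t)"
    "\<And>t. (1 + v t) * deriv v t = c * ((1 + u t) * deriv u t)"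
    "\<And>t. - (L1 t + 2) / (1 + u t) - L2 t / deriv u t - ((1 + v t) / (1 + u t) + deriv v t / deriv u t)
        = \<alpha> * u t + \<beta>"
proof -
  define P where "P t = (1 + u t) * deriv u t" for t
  define Q where "Q t = (1 + v t) * deriv v t" for t
  have PQ: "P t > 0" "Q t > 0" for t using pos by (simp_all add: P_def Q_def)
  have smPQ: "smooth P" "smooth Q"
    unfolding P_def[abs_def] Q_def[abs_def] using sm
    by (auto intro!: smooth_mult smooth_add smooth_const smooth_deriv)
  define \<Lambda> M where "\<Lambda> t = ln (P t)" and "M t = ln (Q t)" for t
  have smL: "smooth \<Lambda>" "smooth M"
    unfolding \<Lambda>_def[abs_def] M_def[abs_def] using smPQ PQ by (auto intro!: smooth_ln)
  have nz: "1 + u t \<noteq> 0" "deriv u t \<noteq> 0" for t using pos(1,2)[of t] by auto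
  have L1: "deriv \<Lambda> t = deriv u t / (1 + u t) + deriv (deriv u) t / deriv u t" for t
  proof -
    have "(\<Lambda> has_real_derivative (deriv u t * deriv u t + deriv (deriv u) t * (1 + u t)) / P t) (at t)"
      unfolding \<Lambda>_def using PQ(1)[of t] unfolding P_def
      by (auto intro!: derivative_eq_intros smooth_DERIV sm smooth_deriv)
    then have "deriv \<Lambda> t = (deriv u t * deriv u t + deriv (deriv u) t * (1 + u t)) / P t"
      by (rule DERIV_imp_deriv)
    then show ?thesis using nz[of t] by (simp add: P_def add_divide_distrib)
  qed
  have dL: "(\<Lambda> has_real_derivative deriv \<Lambda> t) (at t)" "(deriv \<Lambda> has_real_derivative deriv (deriv \<Lambda>) t) (at t)"
    "(M has_real_derivative deriv M t) (at t)" "(deriv M has_real_derivative deriv (deriv M) t) (at t)" for t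
    using smL smooth_DERIV smooth_deriv by blast+
  have ric\<omega>: "ricci_form \<omega> x \<xi> \<eta> = form (\<lambda>t. - (deriv \<Lambda> t + 2)) (\<lambda>t. - deriv (deriv \<Lambda>) t) x \<xi> \<eta>"
    if "x \<in> N" for x \<xi> \<eta>
    using \<omega> pos(1,2) _ dL(1,2) that by (rule ricci_form_form) (simp_all add: \<Lambda>_def P_def)
  have ric\<omega>': "ricci_form \<omega>' x \<xi> \<eta> = form (\<lambda>t. - (deriv M t + 2)) (\<lambda>t. - deriv (deriv M) t) x \<xi> \<eta>"
    if "x \<in> N" for x \<xi> \<eta>
    using \<omega>' pos(3,4) _ dL(3,4) that by (rule ricci_form_form) (simp_all add: M_def Q_def)
  have LM: "deriv \<Lambda> t = deriv M t" for t
  proof -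
    obtain x where x: "x \<in> N" "s x = t" using surj by blast
    have x2: "x $ 2 \<noteq> 0" and gx: "g (x $ 1) > 0" using x(1) g_pos by (auto simp: N_def)
    \<comment> \<open>Fibre directions see only the second coefficient and give equality of second
      derivatives; with these cancelled, base directions give equality of first derivatives.\<close>
    note eq = ric[OF x(1), unfolded ric\<omega>[OF x(1)] ric\<omega>'[OF x(1)] form_def x(2)]
    have "(s' x (axis 2 1))\<^sup>2 + (s' x (axis 2 \<i>))\<^sup>2 \<noteq> 0" unfolding norm_s'_fibre[OF x(1)] using x2 by simp
    moreover have "deriv (deriv \<Lambda>) t * ((s' x (axis 2 1))\<^sup>2 + (s' x (axis 2 \<i>))\<^sup>2) =
        deriv (deriv M) t * ((s' x (axis 2 1))\<^sup>2 + (s' x (axis 2 \<i>))\<^sup>2)"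
      using eq[of "axis 2 1" "axis 2 \<i>"]
      by (simp add: s'_minus[OF x(1)] area_def power2_eq_square algebra_simps)
    ultimately have "deriv (deriv \<Lambda>) t = deriv (deriv M) t" by (rule mult_right_cancel[THEN iffD1])
    then show ?thesis
      using eq[of "axis 1 1" "axis 1 \<i>"] gx by (simp add: area_def)
  qed
  have dLM: "\<Lambda> t - M t = \<Lambda> 0 - M 0" for t
  proof -
    have "((\<lambda>t. \<Lambda> t - M t) has_real_derivative 0) (at t)" for t
      using DERIV_diff[OF dL(1) dL(3), of t] LM by simp
    then show ?thesis by (rule DERIV_zero_const)
  qed
  define c where "c = exp (M 0 - \<Lambda> 0)"
  have c: "(1 + v t) * deriv v t = c * ((1 + u t) * deriv u t)" for t
  proof -
    have "Q t = exp (M t)" "P t = exp (\<Lambda> t)" using PQ by (simp_all add: M_def \<Lambda>_def)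
    moreover have "M t = (M 0 - \<Lambda> 0) + \<Lambda> t" using dLM[of t] by simp
    ultimately have "Q t = c * P t" unfolding c_def by (metis exp_add)
    then show ?thesis by (simp add: P_def Q_def)
  qed
  define \<gamma> where "\<gamma> t = - (deriv \<Lambda> t + 2) / (1 + u t) + - deriv (deriv \<Lambda>) t / deriv u t -
     ((1 + u t + (1 + v t)) / (1 + u t) + (deriv u t + deriv v t) / deriv u t)" for t
  have sm\<gamma>: "smooth \<gamma>"
    unfolding \<gamma>_def[abs_def] using sm smL nz
    by (intro smooth_add smooth_diff smooth_divide smooth_minus smooth_const smooth_deriv) auto
  have smq: "smooth (\<lambda>t. deriv \<gamma> t / deriv u t)"
    using sm sm\<gamma> nz by (intro smooth_divide smooth_deriv) auto
  have G: "scalar_curvature \<omega> x - form_trace \<omega> (\<lambda>x \<xi> \<eta>. \<omega> x \<xi> \<eta> + \<omega>' x \<xi> \<eta>) x = \<gamma> (s x)" if x: "x \<in> N" for x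
  proof -
    have "scalar_curvature \<omega> x = form_trace (form (\<lambda>t. 1 + u t) (deriv u))
       (form (\<lambda>t. - (deriv \<Lambda> t + 2)) (\<lambda>t. - deriv (deriv \<Lambda>) t)) x"
      unfolding scalar_curvature_def by (rule form_trace_cong) (simp_all add: \<omega>[OF x] ric\<omega>[OF x])
    moreover have "form_trace \<omega> (\<lambda>x \<xi> \<eta>. \<omega> x \<xi> \<eta> + \<omega>' x \<xi> \<eta>) x = form_trace (form (\<lambda>t. 1 + u t) (deriv u))
       (form (\<lambda>t. 1 + u t + (1 + v t)) (\<lambda>t. deriv u t + deriv v t)) x"
      by (rule form_trace_cong) (simp_all add: \<omega>[OF x] \<omega>'[OF x] form_add)
    ultimately show ?thesis
      using form_trace_form[OF x, of "\<lambda>t. 1 + u t" "deriv u"] pos(1,2) by (simp add: \<gamma>_def)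
  qed
  have "deriv (\<lambda>t. deriv \<gamma> t / deriv u t) t = 0" for t
  proof -
    obtain x where x: "x \<in> N" "s x = t" using surj by blast
    have "deriv (\<lambda>t. deriv \<gamma> t / deriv u t) (s x) = 0"
      by (rule dbar_grad10_form[OF \<omega> pos(1,2) G smooth_DERIV[OF sm\<gamma>] smooth_DERIV[OF smq] x(1) ext[OF x(1)]])
    then show ?thesis using x(2) by simp
  qed
  then have "((\<lambda>t. deriv \<gamma> t / deriv u t) has_real_derivative 0) (at t)" for t
    using smooth_DERIV[OF smq, of t] by simp
  then have "deriv \<gamma> t / deriv u t = deriv \<gamma> 0 / deriv u 0" for t by (rule DERIV_zero_const)
  then obtain \<alpha> where \<alpha>0: "deriv \<gamma> t / deriv u t = \<alpha>" for t by blast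
  have \<alpha>: "deriv \<gamma> t = \<alpha> * deriv u t" for t using \<alpha>0[of t] nz(2)[of t] by (simp add: field_simps)
  have "\<gamma> t - \<alpha> * u t = \<gamma> 0 - \<alpha> * u 0" for t
  proof -
    have "((\<lambda>t. \<gamma> t - \<alpha> * u t) has_real_derivative 0) (at t)" for t
      using smooth_DERIV[OF sm\<gamma>, of t] smooth_DERIV[OF sm(1), of t] unfolding \<alpha>
      by (auto intro!: derivative_eq_intros)
    then show ?thesis by (rule DERIV_zero_const)
  qed
  then obtain \<beta> where \<beta>: "\<gamma> t = \<alpha> * u t + \<beta>" for t by (metis add.commute diff_add_cancel)
  \<comment> \<open>The trace of the first metric with respect to itself is the constant 2; it moves
    from \<gamma> into the constant term.\<close>
  have "- (deriv \<Lambda> t + 2) / (1 + u t) - deriv (deriv \<Lambda>) t / deriv u t - ((1 + v t) / (1 + u t) + deriv v t / deriv u t)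
        = \<alpha> * u t + (\<beta> + 2)" for t
  proof -
    have split: "(p + q) / p = 1 + q / p" if "p \<noteq> 0" for p q :: real
      using that by (simp add: add_divide_distrib)
    show ?thesis using \<beta>[of t] unfolding \<gamma>_def split[OF nz(1)] split[OF nz(2)] by simp
  qed
  then show ?thesis using that L1 dL(2) c by blast
qed

end

section \<open>Nonexistence\<close>

text \<open>The bundle curvature makes the base form equal to \<open>iddbar\<close> of the logarithm
  of the local norm, hence a multiple of \<open>area\<close>; scalar curvature -2 is exactly the
  assumption \<open>ddg\<close>.\<close>

lemma calabi_model_chart:
  assumes T: "riemann_surface T A" and L: "holomorphic_line_bundle T A L" and h: "hermitian_metric A L h"
    and curv: "\<forall>\<kappa>\<in>A. \<forall>z\<in>chart_image \<kappa>. \<forall>u v. bundle_curvature L h \<kappa> z u v = - \<omega>\<Sigma> \<kappa> z u v"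
    and \<omega>\<Sigma>: "kaehler_form A \<omega>\<Sigma>" "\<forall>\<kappa>\<in>A. \<forall>z\<in>chart_image \<kappa>. curve_scalar_curvature (\<omega>\<Sigma> \<kappa>) z = - 2"
    and \<kappa>: "\<kappa> \<in> A" and t: "t \<in> trivs L"
  defines "U \<equiv> snd \<kappa> ` (fst \<kappa> \<inter> fst t)"
  obtains l' l'' k' k'' where
    "calabi_model U (\<lambda>z. ln (h t (chart_inv \<kappa> z))) l' l'' (\<lambda>z. \<omega>\<Sigma> \<kappa> z 1 \<i>) k' k''"
    "\<And>z u v. z \<in> U \<Longrightarrow> \<omega>\<Sigma> \<kappa> z u v = \<omega>\<Sigma> \<kappa> z 1 \<i> * area u v"
proof -
  have U: "open U" unfolding U_def by (rule chart_open_image[OF T \<kappa> triv_open[OF L t]])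
  have sub: "z \<in> chart_image \<kappa>" if "z \<in> U" for z using that by (auto simp: U_def chart_image_def)
  have hpos: "h t (chart_inv \<kappa> z) > 0" if "z \<in> U" for z
    using h t chart_inv_image(1)[OF T \<kappa> that[unfolded U_def]] unfolding hermitian_metric_def by blast
  have "Cinf_on U (\<lambda>z. h t (chart_inv \<kappa> z))"
    using h t \<kappa> unfolding hermitian_metric_def comp_def U_def by blast
  from twice_deriv_ln_Cinf[OF this U hpos] obtain l' l''
    where l: "twice_deriv U (\<lambda>z. ln (h t (chart_inv \<kappa> z))) l' l''" by blast
  have pos: "\<omega>\<Sigma> \<kappa> z 1 \<i> > 0" if "z \<in> chart_image \<kappa>" for z
  proof -
    have "\<omega>\<Sigma> \<kappa> z u (imult u) > 0" if "u \<noteq> 0" for u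
      using \<omega>\<Sigma>(1) \<kappa> that \<open>z \<in> chart_image \<kappa>\<close> unfolding kaehler_form_def by blast
    from this[of 1] show ?thesis by (simp add: imult_complex_def)
  qed
  have C: "Cinf_on (chart_image \<kappa>) (\<lambda>z. \<omega>\<Sigma> \<kappa> z 1 \<i>)"
    using \<omega>\<Sigma>(1) \<kappa> unfolding kaehler_form_def closed_two_form_def smooth_two_form_def by blast
  have "open (chart_image \<kappa>)" using T \<kappa> unfolding riemann_surface_def by blast
  from twice_deriv_ln_Cinf[OF C this pos] obtain k' k''
    where "twice_deriv (chart_image \<kappa>) (\<lambda>z. ln (\<omega>\<Sigma> \<kappa> z 1 \<i>)) k' k''" by blast
  from twice_deriv_mono[OF this U] sub
  have k: "twice_deriv U (\<lambda>z. ln (\<omega>\<Sigma> \<kappa> z 1 \<i>)) k' k''" by blast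
  have ddl: "iddbar (\<lambda>z. ln (h t (chart_inv \<kappa> z))) z u v = \<omega>\<Sigma> \<kappa> z u v" if "z \<in> U" for z u v
    using iddbar_ln_hermitian[OF T L h \<kappa> t that[unfolded U_def]] curv \<kappa> sub[OF that] by simp
  have "calabi_model U (\<lambda>z. ln (h t (chart_inv \<kappa> z))) l' l'' (\<lambda>z. \<omega>\<Sigma> \<kappa> z 1 \<i>) k' k''"
  proof
    show "iddbar (\<lambda>z. ln (\<omega>\<Sigma> \<kappa> z 1 \<i>)) z 1 \<i> = 2 * \<omega>\<Sigma> \<kappa> z 1 \<i>" if "z \<in> U" for z
    proof -
      have "curve_scalar_curvature (\<omega>\<Sigma> \<kappa>) z = - 2" using \<omega>\<Sigma>(2) \<kappa> sub[OF that] by blast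
      then show ?thesis using pos[OF sub[OF that]] by (simp add: curve_scalar_curvature_def divide_eq_eq)
    qed
  qed (use l k pos sub ddl in auto)
  moreover have "\<omega>\<Sigma> \<kappa> z u v = \<omega>\<Sigma> \<kappa> z 1 \<i> * area u v" if "z \<in> U" for z u v
    using iddbar_complex[OF l that, of u v] ddl[OF that] by simp
  ultimately show ?thesis by (rule that)
qed

text \<open>The momentum is u = f'. The pulled back base form is itself \<open>iddbar s\<close>,
  which supplies the 1 in 1 + u. Positivity and end behaviour of u' come from its role as vertical
  density of a Kaehler metric on the whole fibre; u > 0 follows from its limit 0 at the zero
  divisor.\<close>

lemma (in calabi_model) calabi_ansatz_profile:
  assumes T: "riemann_surface T A" and L: "holomorphic_line_bundle T A L"
    and \<kappa>: "\<kappa> \<in> A" and t: "t \<in> trivs L" and x: "x \<in> fst \<kappa> \<inter> fst t"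
    and U: "U = snd \<kappa> ` (fst \<kappa> \<inter> fst t)" and l_eq: "l = (\<lambda>z. ln (h t (chart_inv \<kappa> z)))"
    and \<omega>\<Sigma>: "\<And>z u v. z \<in> U \<Longrightarrow> \<omega>\<Sigma> \<kappa> z u v = g z * area u v"
    and \<omega>: "calabi_ansatz A L h \<omega>\<Sigma> a \<omega>"
  obtains u where "smooth u" "\<And>r. 1 + u r > 0" "\<And>r. deriv u r > 0"
    "(u \<longlongrightarrow> 0) at_bot" "(u \<longlongrightarrow> a) at_top" "(deriv u \<longlongrightarrow> 0) at_bot" "(deriv u \<longlongrightarrow> 0) at_top"
    "((\<lambda>r. deriv (deriv u) r / deriv u r) \<longlongrightarrow> 1) at_bot"
    "((\<lambda>r. deriv (deriv u) r / deriv u r) \<longlongrightarrow> - 1) at_top"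
    "\<And>y \<xi> \<eta>. y \<in> N \<Longrightarrow> \<omega> (zero_chart L \<kappa> t) y \<xi> \<eta> = form (\<lambda>r. 1 + u r) (deriv u) y \<xi> \<eta>"
proof -
  obtain f :: "real \<Rightarrow> real" where f: "Cinf_on UNIV f" "(deriv f \<longlongrightarrow> 0) at_bot" "(deriv f \<longlongrightarrow> a) at_top"
    and ans: "\<forall>\<kappa>\<in>A. \<forall>t\<in>trivs L. \<forall>y\<in>chart_image (zero_chart L \<kappa> t). y $ 2 \<noteq> 0 \<longrightarrow>
           (\<forall>u v. \<omega> (zero_chart L \<kappa> t) y u v =
              \<omega>\<Sigma> \<kappa> (y $ 1) (u $ 1) (v $ 1) + iddbar (\<lambda>x. f (log_norm h \<kappa> t x)) y u v)"
    using \<omega> unfolding calabi_ansatz_def by blast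
  define u where "u = deriv f"
  have sf: "smooth f" by (rule Cinf_on_imp_smooth[OF f(1)])
  have su: "smooth u" unfolding u_def by (rule smooth_deriv[OF sf])
  have df: "(f has_real_derivative u r) (at r)" for r unfolding u_def by (rule smooth_DERIV[OF sf])
  have du: "(u has_real_derivative deriv u r) (at r)" "(deriv u has_real_derivative deriv (deriv u) r) (at r)" for r
    using smooth_DERIV smooth_deriv su by blast+
  have s: "log_norm h \<kappa> t = s" by (simp add: fun_eq_iff log_norm_def s_def fun_cong[OF l_eq])
  have form: "\<omega> (zero_chart L \<kappa> t) y \<xi> \<eta> = form (\<lambda>r. 1 + u r) (deriv u) y \<xi> \<eta>" if y: "y \<in> N" for y \<xi> \<eta>
  proof -
    have "y \<in> chart_image (zero_chart L \<kappa> t)" "y $ 2 \<noteq> 0"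
      using y chart_image_zero_chart[OF L \<kappa> t, folded U] by (auto simp: N_def)
    then have "\<omega> (zero_chart L \<kappa> t) y \<xi> \<eta> = \<omega>\<Sigma> \<kappa> (y $ 1) (\<xi> $ 1) (\<eta> $ 1) + iddbar (\<lambda>x. f (s x)) y \<xi> \<eta>"
      using ans \<kappa> t unfolding s[symmetric] by blast
    also have "\<dots> = g (y $ 1) * area (\<xi> $ 1) (\<eta> $ 1) + form u (deriv u) y \<xi> \<eta>"
      using \<omega>\<Sigma>[of "y $ 1"] y iddbar_s_compose[OF df du(1) y] by (simp add: N_def)
    also have "\<dots> = form (\<lambda>r. 1 + u r) (deriv u) y \<xi> \<eta>" by (simp add: form_def algebra_simps)
    finally show ?thesis .
  qed
  define z where "z = snd \<kappa> x"
  have z: "z \<in> snd \<kappa> ` (fst \<kappa> \<inter> fst t)" using x by (simp add: z_def)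
  have vert: "\<omega> (zero_chart L \<kappa> t) y (axis 2 1) (axis 2 \<i>) =
      2 * deriv u (l z + ln ((cmod (y $ 2))\<^sup>2)) / (cmod (y $ 2))\<^sup>2" if y: "y $ 1 = z" "y $ 2 \<noteq> 0" for y
  proof -
    have yN: "y \<in> N" using y z[folded U] by (simp add: N_def)
    have "\<omega> (zero_chart L \<kappa> t) y (axis 2 1) (axis 2 \<i>) =
        deriv u (s y) / 2 * ((s' y (axis 2 1))\<^sup>2 + (s' y (axis 2 \<i>))\<^sup>2)"
      unfolding form[OF yN] form_def by (simp add: s'_minus[OF yN] area_def power2_eq_square)
    also have "\<dots> = 2 * deriv u (s y) / (cmod (y $ 2))\<^sup>2"
      unfolding norm_s'_fibre[OF yN] by simp
    finally show ?thesis by (simp add: s_def y(1))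
  qed
  have K: "kaehler_form (ruled_atlas A L) \<omega>" using \<omega> by (simp add: calabi_ansatz_def)
  note b = fibre_profile_boundary[OF T L \<kappa> t z K vert du(2)]
  have "u r > 0" for r using limit_at_bot_less[OF du(1) b(1) f(2)[folded u_def]] .
  then have "1 + u r > 0" for r by (simp add: add_pos_pos)
  from that[OF su this b(1) f(2,3)[folded u_def] b(2-5) form] show ?thesis .
qed

theorem corollary1p3:
  fixes T :: "'a topology"
    and A :: "('a, complex) chart set"
    and \<omega>\<Sigma> :: "('a, complex) chart \<Rightarrow> complex form2"
    and L :: "('a, 'e) line_bundle"
    and h :: "('a, 'e) local_norms"
  assumes surface: "riemann_surface T A" "compact_space T" "has_genus T 2"
    and base_metric: "kaehler_form A \<omega>\<Sigma>"
      "\<forall>\<kappa>\<in>A. \<forall>z\<in>chart_image \<kappa>. curve_scalar_curvature (\<omega>\<Sigma> \<kappa>) z = - 2"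
    and line_bdl: "holomorphic_line_bundle T A L" "has_degree A L (- 1)"
    and hermitian: "hermitian_metric A L h"
      "\<forall>\<kappa>\<in>A. \<forall>z\<in>chart_image \<kappa>. \<forall>u v. bundle_curvature L h \<kappa> z u v = - \<omega>\<Sigma> \<kappa> z u v"
  shows "\<exists>k0>0. vartheta k0 = 0 \<and> (\<forall>x>0. vartheta x = 0 \<longrightarrow> x = k0) \<and> \<bar>k0 - 12.451\<bar> < 0.0005 \<and>
    (\<forall>a>k0. \<exists>\<delta>>0. \<forall>b. 0 < b \<and> b < \<delta> \<longrightarrow>
       \<not> (\<exists>\<omega> \<omega>'. \<omega> \<in> Omega_class A L a \<and> \<omega>' \<in> Omega_class A L b \<and>
                coupled_extremal (ruled_atlas A L) \<omega> \<omega>' \<and>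
                calabi_ansatz A L h \<omega>\<Sigma> a \<omega> \<and> calabi_ansatz A L h \<omega>\<Sigma> b \<omega>'))"
proof -
  obtain k0 where k0: "k0 > 0" "vartheta k0 = 0" "\<forall>x>0. vartheta x = 0 \<longrightarrow> x = k0"
    "\<bar>k0 - 12.451\<bar> < 0.0005" "\<forall>x>k0. vartheta x > 0"
    using vartheta_root by blast
  have "\<exists>\<delta>>0. \<forall>b. 0 < b \<and> b < \<delta> \<longrightarrow>
       \<not> (\<exists>\<omega> \<omega>'. \<omega> \<in> Omega_class A L a \<and> \<omega>' \<in> Omega_class A L b \<and>
                coupled_extremal (ruled_atlas A L) \<omega> \<omega>' \<and>
                calabi_ansatz A L h \<omega>\<Sigma> a \<omega> \<and> calabi_ansatz A L h \<omega>\<Sigma> b \<omega>')"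
    if a: "a > k0" for a
  proof -
    have "12.451 - 0.0005 < k0" using k0(4) unfolding abs_less_iff by simp
    then have a12: "12 < a" using a by simp
    \<comment> \<open>The top coefficients are called \<open>P\<close> and \<open>Q\<close> here,
      since \<open>A\<close> is the atlas.\<close>
    obtain \<delta> where \<delta>: "\<delta> > 0"
      and neg: "\<forall>b e P Q C D. 0 < b \<and> b < \<delta> \<and> 0 \<le> e \<and> e \<le> b * ((1 + a)\<^sup>2 - 1) / 2 \<and>
        C + D - 3/2 + Q + P = 0 \<and> D - 3 + 3 * Q + 4 * P = 1 \<and>
        C + D * (1 + a) - 3/2 * (1 + a)^2 + Q * (1 + a)^3 + P * (1 + a)^4 = e \<and>
        D - 3 * (1 + a) + 3 * Q * (1 + a)^2 + 4 * P * (1 + a)^3 = - (1 + a) + (1 + a) * b \<longrightarrow>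
        C + D * sqrt (1 + a) - 3/2 * (sqrt (1 + a))^2 + Q * (sqrt (1 + a))^3 + P * (sqrt (1 + a))^4 < 0"
      using quartic_negative_at_geometric_mean[OF a12] k0(5) a by blast
    have False
      if b: "0 < b" "b < \<delta>" and cls: "\<omega> \<in> Omega_class A L a"
        and ext: "coupled_extremal (ruled_atlas A L) \<omega> \<omega>'"
        and ans: "calabi_ansatz A L h \<omega>\<Sigma> a \<omega>" "calabi_ansatz A L h \<omega>\<Sigma> b \<omega>'" for b \<omega> \<omega>'
    proof -
      \<comment> \<open>Membership in the class provides a base point. All data depend on s alone,
        so one chart and one trivialization around this point suffice.\<close>
      obtain x \<kappa> where \<kappa>: "\<kappa> \<in> A" "x \<in> fst \<kappa>" using cls by (auto simp: Omega_class_def)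
      have "x \<in> topspace T" using surface(1) \<kappa> unfolding riemann_surface_def by blast
      then obtain t where t: "t \<in> trivs L" "x \<in> fst t"
        using line_bdl(1) unfolding holomorphic_line_bundle_def by blast
      define U where "U = snd \<kappa> ` (fst \<kappa> \<inter> fst t)"
      define l where "l = (\<lambda>z. ln (h t (chart_inv \<kappa> z)))"
      obtain l' l'' k' k'' where model: "calabi_model U l l' l'' (\<lambda>z. \<omega>\<Sigma> \<kappa> z 1 \<i>) k' k''"
        and \<omega>\<Sigma>: "\<And>z u v. z \<in> U \<Longrightarrow> \<omega>\<Sigma> \<kappa> z u v = \<omega>\<Sigma> \<kappa> z 1 \<i> * area u v"
        using calabi_model_chart[OF surface(1) line_bdl(1) hermitian base_metric \<kappa>(1) t(1)]
        unfolding U_def l_def by blast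
      interpret calabi_model U l l' l'' "\<lambda>z. \<omega>\<Sigma> \<kappa> z 1 \<i>" k' k'' by (fact model)
      have x: "x \<in> fst \<kappa> \<inter> fst t" using \<kappa> t by simp
      have xU: "snd \<kappa> x \<in> U" using x by (simp add: U_def)
      note prof = calabi_ansatz_profile[where h = h and \<omega>\<Sigma> = \<omega>\<Sigma>, OF surface(1) line_bdl(1) \<kappa>(1) t(1) x U_def l_def \<omega>\<Sigma>]
      obtain u where u: "smooth u" "\<And>r. 1 + u r > 0" "\<And>r. deriv u r > 0"
        "(u \<longlongrightarrow> 0) at_bot" "(u \<longlongrightarrow> a) at_top" "(deriv u \<longlongrightarrow> 0) at_bot" "(deriv u \<longlongrightarrow> 0) at_top"
        "((\<lambda>r. deriv (deriv u) r / deriv u r) \<longlongrightarrow> 1) at_bot"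
        "((\<lambda>r. deriv (deriv u) r / deriv u r) \<longlongrightarrow> - 1) at_top"
        and u_form: "\<And>y \<xi> \<eta>. y \<in> N \<Longrightarrow> \<omega> (zero_chart L \<kappa> t) y \<xi> \<eta> = form (\<lambda>r. 1 + u r) (deriv u) y \<xi> \<eta>"
        by (rule prof[OF _ ans(1)]) blast+
      obtain v where v: "smooth v" "\<And>r. 1 + v r > 0" "\<And>r. deriv v r > 0"
        "(v \<longlongrightarrow> 0) at_bot" "(v \<longlongrightarrow> b) at_top"
        and v_form: "\<And>y \<xi> \<eta>. y \<in> N \<Longrightarrow> \<omega>' (zero_chart L \<kappa> t) y \<xi> \<eta> = form (\<lambda>r. 1 + v r) (deriv v) y \<xi> \<eta>"
        by (rule prof[OF _ ans(2)]) blast+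
      \<comment> \<open>On the fibre over \<open>x\<close>, s runs through all reals as |w| runs
        through the positive reals.\<close>
      have surj: "\<exists>y\<in>N. s y = r" for r
      proof -
        define w where "w = exp ((r - l (snd \<kappa> x)) / 2)"
        have "ln (w\<^sup>2) = r - l (snd \<kappa> x)" by (simp add: w_def power2_eq_square flip: exp_add)
        then have "s (axis 1 (snd \<kappa> x) + axis 2 (of_real w)) = r" by (simp add: s_def)
        moreover have "axis 1 (snd \<kappa> x) + axis 2 (of_real w) \<in> N" using xU by (simp add: N_def w_def)
        ultimately show ?thesis by blast
      qed
      have NI: "y \<in> chart_image (zero_chart L \<kappa> t)" if "y \<in> N" for y
        using that chart_image_zero_chart[OF line_bdl(1) \<kappa>(1) t(1), folded U_def] by (simp add: N_def)
      have ZA: "zero_chart L \<kappa> t \<in> ruled_atlas A L" by (rule ruled_atlas_charts(1)[OF \<kappa>(1) t(1)])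
      have ric: "ricci_form (\<omega> (zero_chart L \<kappa> t)) y \<xi> \<eta> = ricci_form (\<omega>' (zero_chart L \<kappa> t)) y \<xi> \<eta>"
        if "y \<in> N" for y \<xi> \<eta>
        using ext ZA NI[OF that] unfolding coupled_extremal_def by blast
      have dbar: "dbar 2 (\<lambda>x. grad10 (\<omega> (zero_chart L \<kappa> t))
            (\<lambda>x. scalar_curvature (\<omega> (zero_chart L \<kappa> t)) x
                   - form_trace (\<omega> (zero_chart L \<kappa> t))
                       (\<lambda>x u v. \<omega> (zero_chart L \<kappa> t) x u v + \<omega>' (zero_chart L \<kappa> t) x u v) x) x $ 2) y = 0"
        if "y \<in> N" for y
        using ext ZA NI[OF that] unfolding coupled_extremal_def by blast
      obtain L1 L2 c \<alpha> \<beta> where ode: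
        "\<And>t. L1 t = deriv u t / (1 + u t) + deriv (deriv u) t / deriv u t"
        "\<And>t. (L1 has_real_derivative L2 t) (at t)"
        "\<And>t. (1 + v t) * deriv v t = c * ((1 + u t) * deriv u t)"
        "\<And>t. - (L1 t + 2) / (1 + u t) - L2 t / deriv u t - ((1 + v t) / (1 + u t) + deriv v t / deriv u t)
          = \<alpha> * u t + \<beta>"
        by (rule coupled_extremal_ode[OF u(1) v(1) u(2,3) v(2,3) u_form v_form ric dbar surj]) blast+
      obtain P Q C D e where q: "0 \<le> e" "e \<le> b * ((1 + a)\<^sup>2 - 1) / 2"
        "C + D - 3/2 + Q + P = 0" "D - 3 + 3 * Q + 4 * P = 1"
        "C + D * (1 + a) - 3/2 * (1 + a)^2 + Q * (1 + a)^3 + P * (1 + a)^4 = e"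
        "D - 3 * (1 + a) + 3 * Q * (1 + a)^2 + 4 * P * (1 + a)^3 = - (1 + a) + (1 + a) * b"
        "\<And>r. 0 < C + D * (1 + u r) - 3/2 * (1 + u r)^2 + Q * (1 + u r)^3 + P * (1 + u r)^4"
        using momentum_profile_quartic[OF smooth_DERIV[OF u(1)] smooth_DERIV[OF smooth_deriv[OF u(1)]]
          smooth_DERIV[OF v(1)] u(3) v(3) ode u(4,5) v(4,5) u(6-9)] by blast
      \<comment> \<open>The test point lies strictly between the limits 1 and 1 + a of 1 + u, so u
        attains it by continuity, and the quartic would be both positive and negative there.\<close>
      have sq: "0 < sqrt (1 + a) - 1" "sqrt (1 + a) - 1 < a"
      proof -
        show "0 < sqrt (1 + a) - 1" using a12 by simp
        have "1 + a < (1 + a)\<^sup>2" using a12 by (simp add: power2_eq_square)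
        then have "sqrt (1 + a) < 1 + a" using a12 by (intro real_less_lsqrt) auto
        then show "sqrt (1 + a) - 1 < a" by simp
      qed
      obtain r1 where r1: "u r1 < sqrt (1 + a) - 1"
        using eventually_happens[OF order_tendstoD(2)[OF u(4) sq(1)]] by auto
      obtain r2 where r2: "sqrt (1 + a) - 1 < u r2"
        using eventually_happens[OF order_tendstoD(1)[OF u(5) sq(2)]] by auto
      have "r1 \<le> r2"
      proof (rule ccontr)
        assume "\<not> r1 \<le> r2"
        then have "u r2 \<le> u r1"
          using DERIV_nonneg_imp_nondecreasing[of r2 r1 u] smooth_DERIV[OF u(1)] u(3)
          by (meson less_imp_le not_le)
        then show False using r1 r2 by simp
      qed
      then obtain r where "u r = sqrt (1 + a) - 1"
        using IVT[of u r1 "sqrt (1 + a) - 1" r2] r1 r2 DERIV_isCont[OF smooth_DERIV[OF u(1)]] by auto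
      then have "1 + u r = sqrt (1 + a)" by simp
      note q(7)[of r, unfolded this]
      moreover have "C + D * sqrt (1 + a) - 3/2 * (sqrt (1 + a))^2 + Q * (sqrt (1 + a))^3 + P * (sqrt (1 + a))^4 < 0"
        by (rule neg[THEN spec, of b, THEN spec, of e, THEN spec, of P, THEN spec, of Q, THEN spec, of C,
            THEN spec, of D, THEN mp]) (intro conjI b q(1-6))
      ultimately show False by simp
    qed
    then show ?thesis using \<delta> by blast
  qed
  then show ?thesis using k0 by blast
qed

end
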